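(* Let $(\mathbf{E}^t,\mathbf{H}^t)$ and $(\mathbf{E}^0,\mathbf{H}^0)$ be a pair of eigenfunctions to the electromagnetic interior transmission eigenvalue problem in $\Omega$ with transmission conditions on $\Gamma$, associated with the eigenvalue $\omega\in\mathbb{R}_+$. Assume that $\Omega$ possesses a conical corner $\mathcal{K}_{r_0}$ with $\mathbf{0}\in\Gamma$, where $\mathbf{0}$ is the apex of the cone $\mathcal{K}$, and $$(\mu-\mu_0)\mathbf{H}^t,\ (\gamma-\varepsilon_0)\mathbf{E}^t\in C^\alpha(\overline{\mathcal{K}_{r_0}})^3$$ for some $\alpha\in(0,1)$. Then $$(\mu(\mathbf{0})-\mu_0)\mathbf{H}^t(\mathbf{0})=(\gamma(\mathbf{0})-\varepsilon_0)\mathbf{E}^t(\mathbf{0})=\mathbf{0}.$$ Furthermore, if $\mu(\mathbf{0})\neq\mu_0\neq0$ and $\gamma(\mathbf{0})\neq\varepsilon_0$, one has $\mathbf{H}^t(\mathbf{0})=\mathbf{E}^t(\mathbf{0})=\mathbf{0}$.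
   Context: $\Omega\subset\mathbb{R}^3$ is a bounded Lipschitz domain with connected complement; $\varepsilon_0,\mu_0\in\mathbb{R}_+$ are constants; $\varepsilon,\mu\in L^\infty(\Omega;\mathbb{R}_+)$, $\sigma\in L^\infty(\Omega;\mathbb{R}_+^0)$ (non-negative) and $\gamma=\varepsilon+\mathrm{i}\sigma/\omega$. Conical corner: $\mathcal{K}=\{r\tilde{\mathbf{x}} : r>0,\ \tilde{\mathbf{x}}\in\mathbb{S}^2,\ \text{the angle between } \tilde{\mathbf{x}} \text{ and the axis } \mathbf{e}_3=(0,0,1)^\top \text{ lies in } [0,\theta_0)\}$ with $\theta_0\in(0,\pi/2)$, $\mathcal{K}_{r_0}=\mathcal{K}\cap B_{r_0}(\mathbf{0})$; $\Omega$ possesses the conical corner $\mathcal{K}_{r_0}$ if $\Omega\cap B_{r_0}(\mathbf{0})=\mathcal{K}_{r_0}$ ($r_0>0$ small). Transmission eigenvalue problem: with $\Gamma\subseteq\partial\Omega$ relatively open (possibly $\Gamma=\partial\Omega$), $$\begin{cases}\nabla\wedge\mathbf{E}^t-\mathrm{i}\omega\mu\mathbf{H}^t=\mathbf{0},\quad\nabla\wedge\mathbf{H}^t+\mathrm{i}\omega\gamma\mathbf{E}^t=\mathbf{0}&\text{in }\Omega,\\ \nabla\wedge\mathbf{E}^0-\mathrm{i}\omega\mu_0\mathbf{H}^0=\mathbf{0},\quad\nabla\wedge\mathbf{H}^0+\mathrm{i}\omega\varepsilon_0\mathbf{E}^0=\mathbf{0}&\text{in }\Omega,\\ \nu\wedge\mathbf{E}^t=\nu\wedge\mathbf{E}^0,\quad\nu\wedge\mathbf{H}^t=\nu\wedge\mathbf{H}^0&\text{on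 }\Gamma,\end{cases}$$ where $\nu$ is the exterior unit normal. If for $\omega\in\mathbb{R}_+$ there are nontrivial solutions $(\mathbf{E}^t,\mathbf{H}^t),(\mathbf{E}^0,\mathbf{H}^0)\in H(\mathrm{curl},\Omega)\times H(\mathrm{curl},\Omega)$, then $\omega$ is called an interior transmission eigenvalue and $(\mathbf{E}^t,\mathbf{H}^t),(\mathbf{E}^0,\mathbf{H}^0)$ are corresponding transmission eigenfunctions. Pointwise values at $\mathbf{0}$ are those of the continuous representatives on $\overline{\mathcal{K}_{r_0}}$. *)

theory Defs
  imports "HOL-Analysis.Analysis"
begin

section \<open>Smooth compactly supported fields\<close>

definition partial_deriv :: "3 \<Rightarrow> (real^3 \<Rightarrow> 'b::real_normed_vector) \<Rightarrow> real^3 \<Rightarrow> 'b" where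
  "partial_deriv j f x = frechet_derivative f (at x) (axis j 1)"

primrec C_k :: "nat \<Rightarrow> (real^3 \<Rightarrow> 'b::real_normed_vector) \<Rightarrow> bool" where
  "C_k 0 f \<longleftrightarrow> continuous_on UNIV f"
| "C_k (Suc k) f \<longleftrightarrow> (\<forall>x. f differentiable (at x)) \<and> (\<forall>j. C_k k (partial_deriv j f))"

definition test_fields :: "(real^3) set \<Rightarrow> (real^3 \<Rightarrow> complex^3) set" where
  "test_fields U = {\<phi>. (\<forall>k. C_k k \<phi>) \<and>
     compact (closure {x. \<phi> x \<noteq> 0}) \<and> closure {x. \<phi> x \<noteq> 0} \<subseteq> U}"

definition curl :: "(real^3 \<Rightarrow> complex^3) \<Rightarrow> real^3 \<Rightarrow> complex^3" where
  "curl \<phi> x = vector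
    [partial_deriv 2 \<phi> x $ 3 - partial_deriv 3 \<phi> x $ 2,
     partial_deriv 3 \<phi> x $ 1 - partial_deriv 1 \<phi> x $ 3,
     partial_deriv 1 \<phi> x $ 2 - partial_deriv 2 \<phi> x $ 1]"


section \<open>The space \<open>H(curl, \<Omega>)\<close> and tangential traces\<close>

text \<open>The bilinear product, without complex conjugation.\<close>

definition cdot :: "complex^3 \<Rightarrow> complex^3 \<Rightarrow> complex" where
  "cdot a b = (\<Sum>i\<in>UNIV. a $ i * b $ i)"

definition L2 :: "(real^3) set \<Rightarrow> (real^3 \<Rightarrow> complex^3) set" where
  "L2 \<Omega> = {F. F \<in> borel_measurable (lebesgue_on \<Omega>) \<and>
              integrable (lebesgue_on \<Omega>) (\<lambda>x. (norm (F x))\<^sup>2)}"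

definition has_weak_curl ::
    "(real^3) set \<Rightarrow> (real^3 \<Rightarrow> complex^3) \<Rightarrow> (real^3 \<Rightarrow> complex^3) \<Rightarrow> bool" where
  "has_weak_curl \<Omega> F G \<longleftrightarrow>
     (\<forall>\<phi>\<in>test_fields \<Omega>. (LINT x|lebesgue_on \<Omega>. cdot (F x) (curl \<phi> x)) =
                         (LINT x|lebesgue_on \<Omega>. cdot (G x) (\<phi> x)))"

definition Hcurl :: "(real^3) set \<Rightarrow> (real^3 \<Rightarrow> complex^3) set" where
  "Hcurl \<Omega> = {F \<in> L2 \<Omega>. \<exists>G\<in>L2 \<Omega>. has_weak_curl \<Omega> F G}"

text \<open>For \<open>F \<in> Hcurl \<Omega>\<close> the weak curl is unique up to a null set; all uses below are
  insensitive to the choice of representative.\<close>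

definition weak_curl :: "(real^3) set \<Rightarrow> (real^3 \<Rightarrow> complex^3) \<Rightarrow> real^3 \<Rightarrow> complex^3" where
  "weak_curl \<Omega> F = (SOME G. G \<in> L2 \<Omega> \<and> has_weak_curl \<Omega> F G)"

text \<open>The tangential trace \<open>\<nu> \<and> F\<close> of \<open>F \<in> Hcurl \<Omega>\<close> is only a functional on the boundary; it is
  defined by Green's formula
  \<open>\<langle>\<nu> \<and> F, \<phi>\<rangle> = \<integral>\<^sub>\<Omega> (curl F \<bullet> \<phi> - F \<bullet> curl \<phi>)\<close>, the exterior normal fixing the sign.\<close>

definition tangential_trace ::
    "(real^3) set \<Rightarrow> (real^3 \<Rightarrow> complex^3) \<Rightarrow> (real^3 \<Rightarrow> complex^3) \<Rightarrow> complex" where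
  "tangential_trace \<Omega> F \<phi> =
     (LINT x|lebesgue_on \<Omega>. cdot (weak_curl \<Omega> F x) (\<phi> x) - cdot (F x) (curl \<phi> x))"

text \<open>Equality of traces on a relatively open part \<open>\<Gamma>\<close> of the boundary is equality as functionals
  restricted to \<open>\<Gamma>\<close>: one tests with fields on the whole space whose support meets the boundary
  only inside \<open>\<Gamma>\<close>.\<close>

definition tangential_trace_eq_on ::
    "(real^3) set \<Rightarrow> (real^3) set \<Rightarrow> (real^3 \<Rightarrow> complex^3) \<Rightarrow> (real^3 \<Rightarrow> complex^3) \<Rightarrow> bool" where
  "tangential_trace_eq_on \<Omega> \<Gamma> F G \<longleftrightarrow>
     (\<forall>\<phi>\<in>test_fields (- (frontier \<Omega> - \<Gamma>)). tangential_trace \<Omega> F \<phi> = tangential_trace \<Omega> G \<phi>)"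


section \<open>Domains and conical corners\<close>

text \<open>Near each boundary point, in suitable Cartesian coordinates, the domain lies strictly above
  the graph of a Lipschitz function. That function may be taken on the whole plane, since Lipschitz
  functions extend.\<close>

definition lipschitz_domain :: "(real^3) set \<Rightarrow> bool" where
  "lipschitz_domain \<Omega> \<longleftrightarrow> open \<Omega> \<and> connected \<Omega> \<and> \<Omega> \<noteq> {} \<and>
     (\<forall>p\<in>frontier \<Omega>. \<exists>U (T :: real^3 \<Rightarrow> real^3) (\<psi> :: real \<times> real \<Rightarrow> real) L.
        open U \<and> p \<in> U \<and> orthogonal_transformation T \<and> L-lipschitz_on UNIV \<psi> \<and>
        \<Omega> \<inter> U = {x \<in> U. \<psi> (T (x - p) $ 1, T (x - p) $ 2) < T (x - p) $ 3})"

definition cone :: "real \<Rightarrow> (real^3) set" where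
  "cone \<theta>\<^sub>0 = {r *\<^sub>R y | r y. 0 < r \<and> norm y = 1 \<and> arccos (y \<bullet> axis 3 1) \<in> {0..<\<theta>\<^sub>0}}"

definition truncated_cone :: "real \<Rightarrow> real \<Rightarrow> (real^3) set" where
  "truncated_cone \<theta>\<^sub>0 r\<^sub>0 = cone \<theta>\<^sub>0 \<inter> ball 0 r\<^sub>0"

definition has_conical_corner :: "(real^3) set \<Rightarrow> real \<Rightarrow> real \<Rightarrow> bool" where
  "has_conical_corner \<Omega> \<theta>\<^sub>0 r\<^sub>0 \<longleftrightarrow> \<Omega> \<inter> ball 0 r\<^sub>0 = truncated_cone \<theta>\<^sub>0 r\<^sub>0"


section \<open>Function classes and pointwise values\<close>

definition Linf :: "(real^3) set \<Rightarrow> (real^3 \<Rightarrow> real) set" where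
  "Linf \<Omega> = {f. f \<in> borel_measurable (lebesgue_on \<Omega>) \<and>
               (\<exists>C. AE x in lebesgue_on \<Omega>. \<bar>f x\<bar> \<le> C)}"

definition holder_on :: "real \<Rightarrow> (real^3) set \<Rightarrow> (real^3 \<Rightarrow> 'b::real_normed_vector) \<Rightarrow> bool" where
  "holder_on \<alpha> S g \<longleftrightarrow> (\<exists>C. \<forall>x\<in>S. \<forall>y\<in>S. norm (g x - g y) \<le> C * dist x y powr \<alpha>)"

text \<open>Material coefficients and fields are determined only up to null sets. Membership in
  a Hoelder space on the closure of an open set \<open>K\<close> therefore refers to a representative, and so do
  values at boundary points of \<open>K\<close>: \<open>point_value K f x v\<close> says that \<open>f\<close> has a continuous
  representative on \<open>closure K\<close> and that this (unique) representative takes the value \<open>v\<close> at \<open>x\<close>.\<close>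

definition has_holder_rep :: "real \<Rightarrow> (real^3) set \<Rightarrow> (real^3 \<Rightarrow> 'b::real_normed_vector) \<Rightarrow> bool" where
  "has_holder_rep \<alpha> K f \<longleftrightarrow>
     (\<exists>g. holder_on \<alpha> (closure K) g \<and> (AE x in lebesgue_on K. g x = f x))"

definition point_value ::
    "(real^3) set \<Rightarrow> (real^3 \<Rightarrow> 'b::real_normed_vector) \<Rightarrow> real^3 \<Rightarrow> 'b \<Rightarrow> bool" where
  "point_value K f x v \<longleftrightarrow>
     (\<exists>g. continuous_on (closure K) g \<and> (AE y in lebesgue_on K. g y = f y) \<and> g x = v)"


section \<open>The interior transmission eigenvalue problem\<close>

definition complex_permittivity ::
    "(real^3 \<Rightarrow> real) \<Rightarrow> (real^3 \<Rightarrow> real) \<Rightarrow> real \<Rightarrow> real^3 \<Rightarrow> complex" where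
  "complex_permittivity \<epsilon> \<sigma> \<omega> x = complex_of_real (\<epsilon> x) + \<i> * complex_of_real (\<sigma> x) / complex_of_real \<omega>"

definition maxwell_solution ::
    "(real^3) set \<Rightarrow> real \<Rightarrow> (real^3 \<Rightarrow> real) \<Rightarrow> (real^3 \<Rightarrow> complex) \<Rightarrow>
     (real^3 \<Rightarrow> complex^3) \<Rightarrow> (real^3 \<Rightarrow> complex^3) \<Rightarrow> bool" where
  "maxwell_solution \<Omega> \<omega> \<mu> \<gamma> E H \<longleftrightarrow> E \<in> Hcurl \<Omega> \<and> H \<in> Hcurl \<Omega> \<and>
     (AE x in lebesgue_on \<Omega>.
        weak_curl \<Omega> E x - (\<i> * complex_of_real \<omega> * complex_of_real (\<mu> x)) *s H x = 0) \<and>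
     (AE x in lebesgue_on \<Omega>.
        weak_curl \<Omega> H x + (\<i> * complex_of_real \<omega> * \<gamma> x) *s E x = 0)"

text \<open>Nontriviality means that the four fields do not all vanish.\<close>

definition transmission_eigenfunctions ::
    "(real^3) set \<Rightarrow> (real^3) set \<Rightarrow> real \<Rightarrow> real \<Rightarrow>
     (real^3 \<Rightarrow> real) \<Rightarrow> (real^3 \<Rightarrow> real) \<Rightarrow> (real^3 \<Rightarrow> real) \<Rightarrow> real \<Rightarrow>
     (real^3 \<Rightarrow> complex^3) \<times> (real^3 \<Rightarrow> complex^3) \<Rightarrow>
     (real^3 \<Rightarrow> complex^3) \<times> (real^3 \<Rightarrow> complex^3) \<Rightarrow> bool" where
  "transmission_eigenfunctions \<Omega> \<Gamma> \<epsilon>\<^sub>0 \<mu>\<^sub>0 \<epsilon> \<mu> \<sigma> \<omega> = (\<lambda>(Et, Ht) (E0, H0).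
     maxwell_solution \<Omega> \<omega> \<mu> (complex_permittivity \<epsilon> \<sigma> \<omega>) Et Ht \<and>
     maxwell_solution \<Omega> \<omega> (\<lambda>_. \<mu>\<^sub>0) (\<lambda>_. complex_of_real \<epsilon>\<^sub>0) E0 H0 \<and>
     tangential_trace_eq_on \<Omega> \<Gamma> Et E0 \<and> tangential_trace_eq_on \<Omega> \<Gamma> Ht H0 \<and>
     \<not> (AE x in lebesgue_on \<Omega>. Et x = 0 \<and> Ht x = 0 \<and> E0 x = 0 \<and> H0 x = 0))"

end

theory Submission
  imports Defs
begin

text \<open>Put \<open>D = Et - E0\<close>, \<open>B = Ht - H0\<close>, \<open>J = (\<mu> - \<mu>\<^sub>0) Ht\<close>, \<open>M = (\<gamma> - \<epsilon>\<^sub>0) Et\<close>. Subtracting the two Maxwell systems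
gives \<open>curl D = \<i>\<omega>\<mu>\<^sub>0 B + \<i>\<omega> J\<close> and \<open>curl B = - \<i>\<omega>\<epsilon>\<^sub>0 D - \<i>\<omega> M\<close>. The transmission conditions say that
\<open>D\<close> and \<open>B\<close> have no tangential trace near the apex, so both equations may be tested, in the truncated cone
\<open>K\<close>, with fields that do not vanish on the lateral boundary. The claim is that a source \<open>J\<close>, \<open>M\<close> which
is continuous up to the apex and radiates only fields \<open>D\<close>, \<open>B\<close> with zero Cauchy data on the cone has to
vanish at the apex.

The test fields are \<open>\<chi>(x) exp(\<tau> \<rho>\<cdot>x) v\<close> with a constant vector \<open>v\<close>, a cutoff \<open>\<chi>\<close> and a complex null vector
\<open>\<rho> = \<i> q - e\<^sub>3\<close>, where \<open>q\<close> is a real unit vector orthogonal to \<open>e\<^sub>3\<close>; their modulus is \<open>\<chi> exp(-\<tau> x\<^sub>3)\<close>, so they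
concentrate at the apex as \<open>\<tau> \<rightarrow> \<infinity>\<close>. Only \<open>L\<^sup>2\<close> bounds are known for \<open>D\<close> and \<open>B\<close>, so a pairing with them is
a priori \<open>O(\<tau>^(-3/2))\<close>, whereas the pairing with \<open>J\<close> is of order \<open>\<tau>^(-3)\<close>. The gap is closed by moving the
curl twice: as \<open>\<rho> \<times> \<rho> = 0\<close>, \<open>\<rho> \<times> n\<^sub>1 = \<rho>\<close> and \<open>\<rho> \<times> n\<^sub>2 = n\<^sub>1\<close> for \<open>n\<^sub>2 = - e\<^sub>3\<close>, testing with
\<open>v = n\<^sub>2\<close> in the first equation, \<open>v = n\<^sub>1\<close> in the second and \<open>v = \<rho>\<close> in the first improves the pairings in turn to
\<open>\<integral> D\<cdot>n\<^sub>1 \<chi> e = O(\<tau>^(-5/2))\<close>, \<open>\<integral> B\<cdot>\<rho> \<chi> e = O(\<tau>^(-7/2))\<close> and \<open>\<integral> J\<cdot>\<rho> \<chi> e = O(\<tau>^(-7/2))\<close>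
(lemma \<open>corner_source_orthogonal_to_null_vector\<close>).

On the other hand, rescaling by \<open>\<tau>\<close> and dominated convergence show
\<open>\<tau>\<^sup>3 \<integral> J\<cdot>\<rho> \<chi> e \<rightarrow> \<chi>(0) (J(0)\<cdot>\<rho>) F(\<rho>)\<close>, where \<open>F(\<rho>)\<close> is the integral of \<open>exp(\<rho>\<cdot>x)\<close> over the infinite cone
(lemma \<open>continuous_source_asymptotics\<close>). The real part of \<open>F(\<rho>)\<close> is \<open>2\<pi> cos \<theta>\<^sub>0 sin\<^sup>2 \<theta>\<^sub>0\<close>,
hence positive for \<open>0 < \<theta>\<^sub>0 < \<pi>/2\<close> (lemma \<open>Re_cone_laplace\<close>). Therefore
\<open>J(0)\<cdot>\<rho> = 0\<close>, and three choices of \<open>q\<close> give vectors \<open>\<rho>\<close> that span, so \<open>J(0) = 0\<close>. The system is symmetric in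
\<open>(D, M)\<close> and \<open>(B, J)\<close> up to constants, so \<open>M(0) = 0\<close> as well. The statements about \<open>Ht\<close> and \<open>Et\<close> follow by dividing by
the continuous nonzero coefficients.\<close>


section \<open>Smooth cutoffs and plane waves\<close>

lemma partial_deriv_eq:
  "(f has_derivative D) (at x) \<Longrightarrow> partial_deriv j f x = D (axis j 1)"
  unfolding partial_deriv_def using frechet_derivative_at by metis

text \<open>The recursion defining \<open>C_k\<close> speaks of differentiability only; that each class is contained in the
previous one has to be derived, since the product rule needs the undifferentiated factors one level down.\<close>

lemma C_k_Suc_imp: "C_k (Suc k) f \<Longrightarrow> C_k k f"
proof (induction k arbitrary: f)
  case 0
  then show ?case
    by (auto simp: continuous_on_eq_continuous_at intro: differentiable_imp_continuous_within)
next
  case (Suc k)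
  then show ?case
    by (metis C_k.simps(2))
qed

lemma C_k_const: "C_k k (\<lambda>x. c)"
proof (induction k arbitrary: c)
  case (Suc k)
  have "partial_deriv j (\<lambda>x. c) = (\<lambda>x. 0)" for j
    by (rule ext) (auto intro!: partial_deriv_eq[THEN trans] derivative_eq_intros)
  with Suc show ?case by simp
qed auto

lemma C_k_add:
  "C_k k f \<Longrightarrow> C_k k g \<Longrightarrow> C_k k (\<lambda>x. f x + g x)"
proof (induction k arbitrary: f g)
  case 0
  then show ?case by (auto intro: continuous_intros)
next
  case (Suc k)
  have "partial_deriv j (\<lambda>x. f x + g x) = (\<lambda>x. partial_deriv j f x + partial_deriv j g x)" for j
  proof
    fix x
    have "((\<lambda>x. f x + g x) has_derivative
        (\<lambda>h. frechet_derivative f (at x) h + frechet_derivative g (at x) h)) (at x)"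
      using Suc.prems by (intro has_derivative_add) (auto simp: frechet_derivative_works)
    from partial_deriv_eq[OF this]
    show "partial_deriv j (\<lambda>x. f x + g x) x = partial_deriv j f x + partial_deriv j g x"
      by (simp add: partial_deriv_def)
  qed
  with Suc show ?case by auto
qed

lemma (in bounded_bilinear) C_k_prod:
  "C_k k f \<Longrightarrow> C_k k g \<Longrightarrow> C_k k (\<lambda>x. prod (f x) (g x))"
proof (induction k arbitrary: f g)
  case 0
  then show ?case by (auto intro: continuous_on)
next
  case (Suc k)
  have D: "((\<lambda>x. prod (f x) (g x)) has_derivative
        (\<lambda>h. prod (f x) (frechet_derivative g (at x) h) + prod (frechet_derivative f (at x) h) (g x))) (at x)" for x
      using Suc.prems by (intro FDERIV) (auto simp: frechet_derivative_works)
  have "partial_deriv j (\<lambda>x. prod (f x) (g x)) =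
     (\<lambda>x. prod (f x) (partial_deriv j g x) + prod (partial_deriv j f x) (g x))" for j
    using partial_deriv_eq[OF D] by (auto simp: partial_deriv_def)
  moreover have "(\<lambda>x. prod (f x) (g x)) differentiable (at x)" for x
    using D differentiable_def by blast
  moreover have "C_k k f" "C_k k g" using Suc.prems C_k_Suc_imp by blast+
  ultimately show ?case using Suc by (auto intro!: C_k_add)
qed

lemma C_k_bounded_linear:
  assumes "bounded_linear f"
  shows "C_k k f"
proof (cases k)
  case 0
  with assms show ?thesis by (simp add: linear_continuous_on)
next
  case (Suc k')
  have D: "(f has_derivative f) (at x)" for x
    using assms by (simp add: bounded_linear_imp_has_derivative)
  then have "partial_deriv j f = (\<lambda>x. f (axis j 1))" for j
    by (auto simp: partial_deriv_eq[OF D])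
  with D Suc show ?thesis by (auto simp: differentiable_def C_k_const)
qed

lemma partial_deriv_chain_real:
  fixes q :: "real^3 \<Rightarrow> real"
  assumes "(h has_real_derivative d) (at (q x))" "q differentiable (at x)"
  shows "partial_deriv j (\<lambda>x. h (q x)) x = d * partial_deriv j q x"
    and "(\<lambda>x. h (q x)) differentiable (at x)"
proof -
  have "((\<lambda>x. h (q x)) has_derivative (\<lambda>y. d * frechet_derivative q (at x) y)) (at x)"
    using has_derivative_compose[of q "frechet_derivative q (at x)" x UNIV h "(*) d"] assms
    by (auto simp: frechet_derivative_works has_field_derivative_def)
  then show "partial_deriv j (\<lambda>x. h (q x)) x = d * partial_deriv j q x"
    "(\<lambda>x. h (q x)) differentiable (at x)"
    using partial_deriv_eq[of "\<lambda>x. h (q x)" _ x j]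
    by (auto simp: partial_deriv_def[of j q] differentiable_def)
qed

text \<open>The functions \<open>s^(-m) exp(-1/s)\<close>, extended by zero. For \<open>m = 0\<close> this is the classical smooth function that is flat
at the origin. The exponent \<open>m\<close> makes the family closed under differentiation up to linear combinations, which
turns smoothness into an induction over all \<open>m\<close> at once.\<close>

definition flat :: "nat \<Rightarrow> real \<Rightarrow> real" where
  "flat m s = (if s > 0 then (1 / s) ^ m * exp (- (1 / s)) else 0)"

lemma flat_has_derivative:
  "(flat m has_real_derivative flat (m + 2) s - real m * flat (m + 1) s) (at s)"
proof -
  consider "s > 0" | "s < 0" | "s = 0" by linarith
  then show ?thesis
  proof cases
    case 1
    have d: "((\<lambda>s. 1 / s) has_real_derivative - ((1 / s) ^ 2)) (at s)"
      using 1 by (auto intro!: derivative_eq_intros simp: power2_eq_square)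
    have "((\<lambda>s. (1 / s) ^ m * exp (- (1 / s))) has_real_derivative
        flat (m + 2) s - real m * flat (m + 1) s) (at s)"
      using DERIV_mult[OF DERIV_power[OF d, of m] DERIV_fun_exp[OF DERIV_minus[OF d]]] 1
      by (cases m) (simp_all add: flat_def algebra_simps power2_eq_square)
    then show ?thesis
      by (rule has_field_derivative_transform_within_open[where S = "{0<..}"])
        (use 1 in \<open>auto simp: flat_def\<close>)
  next
    case 2
    have "((\<lambda>s. 0) has_real_derivative flat (m + 2) s - real m * flat (m + 1) s) (at s)"
      using 2 by (auto intro!: derivative_eq_intros simp: flat_def)
    then show ?thesis
      by (rule has_field_derivative_transform_within_open[where S = "{..<0}"])
        (use 2 in \<open>auto simp: flat_def\<close>)
  next
    case 3
    \<comment> \<open>The difference quotient at zero, written in the variable \<open>1 / h\<close>.\<close>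
    have "((\<lambda>h. (inverse h) ^ (m + 1) / exp (inverse h)) \<longlongrightarrow> 0) (at_right (0::real))"
      by (rule filterlim_compose[OF tendsto_power_div_exp_0 filterlim_inverse_at_top_right])
    then have R: "((\<lambda>h. flat m h / h) \<longlongrightarrow> 0) (at_right 0)"
      by (rule Lim_transform_eventually)
        (auto simp: eventually_at_filter flat_def exp_minus field_simps intro!: always_eventually)
    have L: "((\<lambda>h. flat m h / h) \<longlongrightarrow> 0) (at_left 0)"
      by (rule tendsto_eventually) (auto simp: eventually_at_filter flat_def intro!: always_eventually)
    have "((\<lambda>h. flat m h / h) \<longlongrightarrow> 0) (at 0)"
      using L R by (simp add: filterlim_at_split)
    then show ?thesis using 3 by (simp add: DERIV_def flat_def)
  qed
qed

lemma C_k_flat: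
  fixes q :: "real^3 \<Rightarrow> real"
  assumes "\<And>k. C_k k q"
  shows "C_k k (\<lambda>x. flat m (q x))"
proof (induction k arbitrary: m)
  case 0
  have "continuous_on UNIV (flat m)"
    using flat_has_derivative DERIV_isCont by (blast intro: continuous_at_imp_continuous_on)
  moreover have "continuous_on UNIV q" using assms[of 0] by simp
  ultimately show ?case
    using continuous_on_compose2 by fastforce
next
  case (Suc k)
  have q: "q differentiable (at x)" "C_k k (partial_deriv j q)" for x j
    using assms[of "Suc k"] by auto
  note ch = partial_deriv_chain_real[OF flat_has_derivative q(1)]
  have "partial_deriv j (\<lambda>x. flat m (q x)) =
      (\<lambda>x. (flat (m+2) (q x) + (- real m) * flat (m+1) (q x)) * partial_deriv j q x)" for j
    using ch(1) by auto
  moreover have "C_k k (\<lambda>x. (flat (m+2) (q x) + (- real m) * flat (m+1) (q x)) * partial_deriv j q x)" for j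
    using Suc q by (intro bounded_bilinear.C_k_prod[OF bounded_bilinear_mult] C_k_add C_k_const)
  ultimately show ?case using ch(2) by auto
qed

text \<open>The bilinear product of a complex vector with a real point, without conjugation.\<close>

definition lin :: "complex^3 \<Rightarrow> real^3 \<Rightarrow> complex" where
  "lin \<rho> x = (\<Sum>i\<in>UNIV. \<rho> $ i * complex_of_real (x $ i))"

lemma bounded_linear_lin: "bounded_linear (lin \<rho>)"
  unfolding lin_def linear_conv_bounded_linear[symmetric]
  by (intro linearI) (auto simp: algebra_simps sum.distrib sum_distrib_left scaleR_conv_of_real[where 'a=complex])

lemma lin_axis: "lin \<rho> (axis j 1) = \<rho> $ j"
  unfolding lin_def axis_def by (simp add: if_distrib cong: if_cong)

lemma exp_lin_has_derivative:
  "((\<lambda>x. exp (lin \<rho> x)) has_derivative (\<lambda>h. lin \<rho> h * exp (lin \<rho> x))) (at x)"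
proof -
  have "(exp has_derivative (\<lambda>h. exp (lin \<rho> x) * h)) (at (lin \<rho> x))"
    using DERIV_exp[of "lin \<rho> x"] by (simp add: has_field_derivative_def)
  from has_derivative_compose[OF bounded_linear_imp_has_derivative[OF bounded_linear_lin] this]
  show ?thesis by (simp add: mult.commute)
qed

lemma C_k_exp_lin: "C_k k (\<lambda>x. exp (lin \<rho> x))"
proof (induction k)
  case 0
  show ?case
    using linear_continuous_on[OF bounded_linear_lin] by (auto intro!: continuous_on_exp)
next
  case (Suc k)
  have "partial_deriv j (\<lambda>x. exp (lin \<rho> x)) = (\<lambda>x. \<rho> $ j * exp (lin \<rho> x))" for j
    using partial_deriv_eq[OF exp_lin_has_derivative] lin_axis by force
  moreover have "C_k k (\<lambda>x. \<rho> $ j * exp (lin \<rho> x))" for j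
    by (intro bounded_bilinear.C_k_prod[OF bounded_bilinear_mult] C_k_const Suc)
  ultimately show ?case
    using exp_lin_has_derivative[of \<rho>] unfolding differentiable_def C_k.simps by metis
qed

lemma norm_smult_vec: "norm (z *s v) = norm z * norm (v :: complex^3)"
  by (simp add: norm_vec_def norm_mult L2_set_right_distrib)

lemma bounded_bilinear_smult_vec: "bounded_bilinear (\<lambda>z v :: complex^3. z *s v)"
proof
  show "\<exists>K. \<forall>a (b :: complex^3). norm (a *s b) \<le> norm a * norm b * K"
    by (intro exI[of _ 1]) (simp add: norm_smult_vec)
qed (auto simp: vec_eq_iff algebra_simps scaleR_conv_of_real[where 'a=complex])

definition ccross :: "complex^3 \<Rightarrow> complex^3 \<Rightarrow> complex^3" where
  "ccross a b = vector [a $ 2 * b $ 3 - a $ 3 * b $ 2, a $ 3 * b $ 1 - a $ 1 * b $ 3, a $ 1 * b $ 2 - a $ 2 * b $ 1]"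

lemma cdot_3: "cdot a b = a $ 1 * b $ 1 + a $ 2 * b $ 2 + a $ 3 * b $ 3"
  by (simp add: cdot_def sum_3)

lemma norm_cdot_le: "norm (cdot a b) \<le> 3 * norm a * norm b"
proof -
  have "norm (cdot a b) \<le> (\<Sum>i\<in>(UNIV :: 3 set). norm a * norm b)"
    unfolding cdot_def by (intro sum_norm_le) (simp add: norm_mult mult_mono Finite_Cartesian_Product.norm_nth_le)
  then show ?thesis by simp
qed

lemma norm_ccross_le: "norm (ccross a b) \<le> 6 * norm a * norm b"
proof -
  have "norm (x * y - z * w) \<le> 2 * (norm a * norm b)"
    if "norm x \<le> norm a" "norm z \<le> norm a" "norm y \<le> norm b" "norm w \<le> norm b" for x y z w :: complex
    using norm_triangle_ineq4[of "x * y" "z * w"] mult_mono[OF that(1,3)] mult_mono[OF that(2,4)]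
    by (simp add: norm_mult)
  then have "norm (ccross a b $ i) \<le> 2 * (norm a * norm b)" for i
    using exhaust_3[of i] by (auto simp: ccross_def Finite_Cartesian_Product.norm_nth_le)
  then have "(\<Sum>i\<in>UNIV. norm (ccross a b $ i)) \<le> (\<Sum>i\<in>(UNIV :: 3 set). 2 * (norm a * norm b))"
    by (intro sum_mono)
  moreover have "norm (ccross a b) \<le> (\<Sum>i\<in>UNIV. norm (ccross a b $ i))"
    unfolding norm_vec_def by (intro L2_set_le_sum) auto
  ultimately show ?thesis by simp
qed

lemma cdot_add_right: "cdot a (b + c) = cdot a b + cdot a c"
  and cdot_add_left: "cdot (a + b) c = cdot a c + cdot b c"
  and cdot_smult_right: "cdot a (z *s b) = z * cdot a b"
  and cdot_smult_left: "cdot (z *s a) b = z * cdot a b"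
  by (simp_all add: cdot_3 algebra_simps)

lemma power_le_exp: "0 \<le> y \<Longrightarrow> y ^ m \<le> real m ^ m * exp (y :: real)"
proof (cases "m = 0")
  case False
  assume "0 \<le> y"
  then have "(y / real m) ^ m \<le> exp (y / real m) ^ m"
    using exp_ge_add_one_self[of "y / real m"] by (intro power_mono) (linarith, simp)
  also have "\<dots> = exp y" using False by (simp flip: exp_of_nat_mult)
  finally show ?thesis using False by (simp add: power_divide field_simps)
qed simp

lemma flat_nonneg: "0 \<le> flat m s"
  by (simp add: flat_def)

lemma flat_le: "flat m s \<le> real m ^ m"
proof (cases "s > 0")
  case True
  then have "(1 / s) ^ m * exp (- (1 / s)) \<le> real m ^ m * exp (1 / s) * exp (- (1 / s))"
    by (intro mult_right_mono power_le_exp) auto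
  also have "\<dots> = real m ^ m" by (simp add: mult.assoc flip: exp_add)
  finally show ?thesis using True by (simp add: flat_def)
qed (simp add: flat_def)

definition cutoff :: "real \<Rightarrow> real^3 \<Rightarrow> real" where
  "cutoff R x = flat 0 (R ^ 4 - (x \<bullet> x)\<^sup>2)"

definition cutoff_grad :: "real \<Rightarrow> real^3 \<Rightarrow> complex^3" where
  "cutoff_grad R x = (\<chi> j. of_real (flat 2 (R ^ 4 - (x \<bullet> x)\<^sup>2) * (- 4 * (x \<bullet> x) * x $ j)))"

lemma cutoff_0: "0 < R \<Longrightarrow> 0 < cutoff R 0"
  by (simp add: cutoff_def flat_def)

lemma cutoff_bounds: "0 \<le> cutoff R x" "cutoff R x \<le> 1"
  using flat_nonneg[of 0] flat_le[of 0] by (simp_all add: cutoff_def)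

lemma cutoff_outside: "0 \<le> R \<Longrightarrow> R \<le> norm x \<Longrightarrow> cutoff R x = 0"
proof -
  assume "0 \<le> R" "R \<le> norm x"
  then have "R ^ 4 \<le> norm x ^ 4" by (rule power_mono[rotated])
  also have "norm x ^ 4 = (x \<bullet> x)\<^sup>2" by (simp add: power2_norm_eq_inner[symmetric])
  finally show ?thesis by (simp add: cutoff_def flat_def)
qed

lemma cutoff_poly_has_derivative:
  "((\<lambda>x. R ^ 4 - (x \<bullet> x)\<^sup>2) has_derivative (\<lambda>h. - 4 * (x \<bullet> x) * (x \<bullet> h))) (at (x :: real^3))"
proof -
  have a: "((\<lambda>x. x \<bullet> x) has_derivative (\<lambda>h. 2 * (x \<bullet> h))) (at x)"
    using has_derivative_inner[OF has_derivative_ident has_derivative_ident, of x UNIV]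
    by (simp add: inner_commute)
  show ?thesis
    using has_derivative_diff[OF has_derivative_const[of "R ^ 4"] has_derivative_mult[OF a a]]
    by (simp add: power2_eq_square mult_ac)
qed

text \<open>The cutoff is a flat function of \<open>R\<^sup>4 - |x|\<^sup>4\<close>. It is not constant near the origin; it is enough that its
gradient is of order \<open>|x|\<^sup>3\<close>, and the fourth power is chosen to achieve this. Every factor \<open>|x|\<close> in a pairing with a plane
wave costs a power of the frequency, so the commutator with the cutoff is of lower order.\<close>

lemma C_k_cutoff: "C_k k (cutoff R)"
proof -
  have id: "C_k k (\<lambda>x. x)" for k by (intro C_k_bounded_linear bounded_linear_ident)
  have "C_k k (\<lambda>x. R ^ 4 + (-1) * ((x \<bullet> x) * (x \<bullet> x)))" for k
    by (intro C_k_add C_k_const bounded_bilinear.C_k_prod[OF bounded_bilinear_mult]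
        bounded_bilinear.C_k_prod[OF bounded_bilinear_inner] id)
  then have "C_k k (\<lambda>x. flat 0 (R ^ 4 + (-1) * ((x \<bullet> x) * (x \<bullet> x))))" by (rule C_k_flat)
  then show ?thesis by (simp add: cutoff_def[abs_def] power2_eq_square)
qed

lemma partial_deriv_cutoff: "complex_of_real (partial_deriv j (cutoff R) x) = cutoff_grad R x $ j"
proof -
  have d: "(\<lambda>x. R ^ 4 - (x \<bullet> x)\<^sup>2) differentiable (at x)"
    by (rule differentiableI[OF cutoff_poly_has_derivative])
  show ?thesis
    using partial_deriv_chain_real(1)[OF flat_has_derivative[of 0] d, of j]
      partial_deriv_eq[OF cutoff_poly_has_derivative, of j R x]
    by (simp add: cutoff_def[abs_def] cutoff_grad_def inner_axis numeral_2_eq_2)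
qed

lemma norm_cutoff_grad: "norm (cutoff_grad R x) \<le> 48 * norm x ^ 3"
proof -
  have "norm (cutoff_grad R x $ j) \<le> 16 * norm x ^ 3" for j
  proof -
    have "norm (cutoff_grad R x $ j) = flat 2 (R ^ 4 - (x \<bullet> x)\<^sup>2) * (4 * (x \<bullet> x) * \<bar>x $ j\<bar>)"
      using flat_nonneg by (simp add: cutoff_grad_def norm_mult abs_mult)
    also have "\<dots> \<le> 4 * (4 * (norm x)\<^sup>2 * norm x)"
      using flat_le[of 2] component_le_norm_cart[of x j] unfolding power2_norm_eq_inner
      by (intro mult_mono) auto
    finally show ?thesis by (simp add: power3_eq_cube power2_eq_square)
  qed
  then have "(\<Sum>i\<in>UNIV. norm (cutoff_grad R x $ i)) \<le> (\<Sum>i\<in>(UNIV :: 3 set). 16 * norm x ^ 3)"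
    by (intro sum_mono)
  moreover have "norm (cutoff_grad R x) \<le> (\<Sum>i\<in>UNIV. norm (cutoff_grad R x $ i))"
    unfolding norm_vec_def by (intro L2_set_le_sum) auto
  ultimately show ?thesis by simp
qed

definition wave :: "real \<Rightarrow> complex^3 \<Rightarrow> complex^3 \<Rightarrow> real^3 \<Rightarrow> complex^3" where
  "wave R \<rho> v x = (of_real (cutoff R x) * exp (lin \<rho> x)) *s v"

lemma C_k_wave: "C_k k (wave R \<rho> v)"
proof -
  have "C_k k (\<lambda>x. (cutoff R x *\<^sub>R exp (lin \<rho> x)) *s v)"
    by (intro bounded_bilinear.C_k_prod[OF bounded_bilinear_smult_vec]
        bounded_bilinear.C_k_prod[OF bounded_bilinear_scaleR] C_k_cutoff C_k_exp_lin C_k_const)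
  then show ?thesis by (simp add: wave_def[abs_def] scaleR_conv_of_real)
qed

text \<open>The support is only required to avoid the part of the boundary where no transmission condition holds; it may
meet the lateral surface of the cone.\<close>

lemma wave_test_field:
  assumes "0 \<le> R" "cball 0 R \<subseteq> U"
  shows "wave R \<rho> v \<in> test_fields U"
proof -
  have "{x. wave R \<rho> v x \<noteq> 0} \<subseteq> cball 0 R"
    using cutoff_outside[OF assms(1)] by (force simp: wave_def)
  then have "closure {x. wave R \<rho> v x \<noteq> 0} \<subseteq> cball 0 R"
    by (simp add: closure_minimal)
  moreover from this have "compact (closure {x. wave R \<rho> v x \<noteq> 0})"
    using bounded_subset[OF bounded_cball] by (simp only: compact_eq_bounded_closed closed_closure simp_thms)
  ultimately show ?thesis
    using assms C_k_wave by (auto simp: test_fields_def)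
qed

text \<open>The first summand is the plane wave with the rotated polarisation, the second is the cutoff error.\<close>

lemma curl_wave:
  "curl (wave R \<rho> v) x = wave R \<rho> (ccross \<rho> v) x + exp (lin \<rho> x) *s ccross (cutoff_grad R x) v"
proof -
  have c: "cutoff R differentiable (at x)" using C_k_cutoff[of "Suc 0" R] by simp
  have "((\<lambda>x. (cutoff R x *\<^sub>R exp (lin \<rho> x)) *s v) has_derivative
      (\<lambda>h. (cutoff R x *\<^sub>R (lin \<rho> h * exp (lin \<rho> x)) + frechet_derivative (cutoff R) (at x) h *\<^sub>R exp (lin \<rho> x)) *s v)) (at x)"
    using bounded_bilinear.FDERIV[OF bounded_bilinear_smult_vec
        bounded_bilinear.FDERIV[OF bounded_bilinear_scaleR c[unfolded frechet_derivative_works] exp_lin_has_derivative]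
        has_derivative_const[of v]]
    by simp
  then have "partial_deriv j (wave R \<rho> v) x =
     (cutoff R x *\<^sub>R (\<rho> $ j * exp (lin \<rho> x)) + partial_deriv j (cutoff R) x *\<^sub>R exp (lin \<rho> x)) *s v" for j
    using partial_deriv_eq by (fastforce simp: wave_def[abs_def] scaleR_conv_of_real[where 'a=complex] lin_axis partial_deriv_def)
  then have "partial_deriv j (wave R \<rho> v) x =
     (of_real (cutoff R x) * exp (lin \<rho> x) * \<rho> $ j + exp (lin \<rho> x) * cutoff_grad R x $ j) *s v" for j
    by (simp add: scaleR_conv_of_real[where 'a=complex] partial_deriv_cutoff mult_ac)
  then show ?thesis
    by (simp add: curl_def ccross_def wave_def vec_eq_iff forall_3 algebra_simps)
qed


section \<open>The Laplace transform of a circular cone\<close>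

lemma cone_iff_norm: "0 \<le> \<theta> \<Longrightarrow> \<theta> \<le> pi \<Longrightarrow> x \<in> cone \<theta> \<longleftrightarrow> cos \<theta> * norm x < x $ 3"
proof -
  assume th: "0 \<le> \<theta>" "\<theta> \<le> pi"
  have ax: "y \<bullet> axis 3 1 = y $ 3" for y :: "real^3"
    by (simp add: inner_axis)
  have arc: "arccos y \<in> {0..<\<theta>} \<longleftrightarrow> cos \<theta> < y" if "\<bar>y\<bar> \<le> 1" for y
    using that th arccos_lbound[of y] arccos_less_mono[of y "cos \<theta>"] arccos_cos[of \<theta>] by auto
  have le: "\<bar>y $ 3\<bar> \<le> 1" if "norm y = 1" for y :: "real^3"
    using that component_le_norm_cart[of y 3] by simp
  show ?thesis
  proof
    assume "x \<in> cone \<theta>"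
    then obtain r y where "x = r *\<^sub>R y" "0 < r" "norm y = 1" "arccos (y $ 3) \<in> {0..<\<theta>}"
      unfolding cone_def ax by blast
    then show "cos \<theta> * norm x < x $ 3"
      using arc[OF le[of y]] by simp
  next
    assume *: "cos \<theta> * norm x < x $ 3"
    then have "x \<noteq> 0" by auto
    define y where "y = x /\<^sub>R norm x"
    have "norm y = 1" "x = norm x *\<^sub>R y" using \<open>x \<noteq> 0\<close> by (auto simp: y_def)
    moreover have "cos \<theta> < y $ 3"
      using * \<open>x \<noteq> 0\<close> by (simp add: y_def field_simps)
    ultimately show "x \<in> cone \<theta>"
      using arc[OF le[of y]] \<open>x \<noteq> 0\<close> unfolding cone_def ax by (metis (mono_tags, lifting) mem_Collect_eq zero_less_norm_iff)
  qed
qed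

text \<open>Slices of the cone at height \<open>z\<close> are discs of radius \<open>z tan \<theta>\<close>, which suits Fubini's theorem.\<close>

lemma cone_iff:
  assumes "0 \<le> \<theta>" "\<theta> < pi / 2"
  shows "x \<in> cone \<theta> \<longleftrightarrow> 0 < x $ 3 \<and> (x $ 1)\<^sup>2 + (x $ 2)\<^sup>2 < (tan \<theta> * x $ 3)\<^sup>2"
proof -
  have c: "0 < cos \<theta>" using assms by (intro cos_gt_zero_pi) auto
  have n: "(norm x)\<^sup>2 = (x $ 1)\<^sup>2 + (x $ 2)\<^sup>2 + (x $ 3)\<^sup>2"
    by (simp add: norm_vec_def L2_set_def sum_3)
  have "cos \<theta> * norm x < x $ 3 \<longleftrightarrow> 0 < x $ 3 \<and> (cos \<theta> * norm x)\<^sup>2 < (x $ 3)\<^sup>2"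
    using c by (smt (verit, best) mult_nonneg_nonneg norm_ge_zero power2_less_imp_less power_strict_mono zero_less_numeral)
  also have "(cos \<theta> * norm x)\<^sup>2 < (x $ 3)\<^sup>2 \<longleftrightarrow> (cos \<theta>)\<^sup>2 * ((x $ 1)\<^sup>2 + (x $ 2)\<^sup>2) < (sin \<theta>)\<^sup>2 * (x $ 3)\<^sup>2"
    unfolding power_mult_distrib n sin_squared_eq by (auto simp: algebra_simps)
  also have "\<dots> \<longleftrightarrow> (x $ 1)\<^sup>2 + (x $ 2)\<^sup>2 < (tan \<theta> * x $ 3)\<^sup>2"
    using c by (simp add: tan_def power_divide power_mult_distrib field_simps)
  finally show ?thesis using cone_iff_norm[of \<theta> x] assms by auto
qed

lemma open_cone: "0 \<le> \<theta> \<Longrightarrow> \<theta> \<le> pi \<Longrightarrow> open (cone \<theta>)"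
proof -
  assume "0 \<le> \<theta>" "\<theta> \<le> pi"
  then have "cone \<theta> = {x. cos \<theta> * norm x < x $ 3}" using cone_iff_norm by blast
  then show ?thesis by (auto intro!: open_Collect_less continuous_intros)
qed

lemma lborel_integral_scale:
  fixes f :: "'a::euclidean_space \<Rightarrow> 'b::{banach, second_countable_topology}"
  assumes f[measurable]: "f \<in> borel_measurable borel" and c: "0 < c"
  shows "(\<integral>x. f x \<partial>lborel) = c ^ DIM('a) *\<^sub>R (\<integral>x. f (c *\<^sub>R x) \<partial>lborel)"
  using c by (subst lborel_affine[of c 0]) (simp_all add: integral_density integral_distr)

lemma lborel_integrable_scale:
  fixes f :: "'a::euclidean_space \<Rightarrow> 'b::{banach, second_countable_topology}"
  assumes f: "integrable lborel f" and c: "0 < c"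
  shows "integrable lborel (\<lambda>x. f (c *\<^sub>R x))"
proof -
  have [measurable]: "f \<in> borel_measurable borel" using f by simp
  have "integrable lborel (\<lambda>x. c ^ DIM('a) *\<^sub>R f (c *\<^sub>R x))"
    using f c by (subst (asm) lborel_affine[of c 0]) (simp_all add: integrable_density integrable_distr_eq)
  from integrable_scaleR_right[OF this, of "inverse (c ^ DIM('a))"] show ?thesis
    using c by simp
qed

lemma emeasure_lborel_Times:
  fixes A :: "'a::euclidean_space set" and B :: "'b::euclidean_space set"
  assumes "A \<in> sets borel" "B \<in> sets borel"
  shows "emeasure lborel (A \<times> B) = emeasure lborel A * emeasure lborel B"
  using lborel.emeasure_pair_measure_Times[of A lborel B] assms by (simp add: lborel_prod)

text \<open>The height is placed first, so that Fubini's theorem integrates over horizontal slices. The two axes \<open>i\<close>, \<open>j\<close> of a slice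
may be interchanged, which covers plane waves oscillating along either of them.\<close>

definition vec3 :: "3 \<Rightarrow> 3 \<Rightarrow> real \<times> real \<times> real \<Rightarrow> real^3" where
  "vec3 i j = (\<lambda>(z, x, y). \<chi> k. if k = i then x else if k = j then y else z)"

lemma vec3_measurable[measurable]: "vec3 i j \<in> borel_measurable borel"
  unfolding vec3_def case_prod_beta
  by (intro borel_measurable_continuous_onI continuous_on_vec_lambda, rename_tac k,
      case_tac "k = i"; case_tac "k = j") (auto intro!: continuous_intros)

lemma lborel_vec3:
  assumes "(i, j) \<in> {(1, 2), (2, 1)}"
  shows "lborel = distr lborel borel (vec3 i j)"
proof (rule lborel_eqI)
  fix l u :: "real^3"
  assume le: "\<And>b. b \<in> Basis \<Longrightarrow> l \<bullet> b \<le> u \<bullet> b"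
  have le': "l $ k \<le> u $ k" for k
    using le[of "axis k 1"] by (simp add: inner_axis)
  have "vec3 i j -` box l u = {l $ 3<..<u $ 3} \<times> {l $ i<..<u $ i} \<times> {l $ j<..<u $ j}"
    using assms by (auto simp: vec3_def mem_box_cart forall_3)
  then have "emeasure (distr lborel borel (vec3 i j)) (box l u)
      = emeasure lborel ({l $ 3<..<u $ 3} \<times> {l $ i<..<u $ i} \<times> {l $ j<..<u $ j})"
    by (simp add: emeasure_distr)
  also have "\<dots> = emeasure lborel {l $ 3<..<u $ 3} * (emeasure lborel {l $ i<..<u $ i} * emeasure lborel {l $ j<..<u $ j})"
    by (simp add: emeasure_lborel_Times borel_Times)
  also have "\<dots> = ennreal ((u $ 3 - l $ 3) * ((u $ i - l $ i) * (u $ j - l $ j)))"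
    using le' by (simp add: ennreal_mult)
  also have "(u $ 3 - l $ 3) * ((u $ i - l $ i) * (u $ j - l $ j)) = (\<Prod>k\<in>UNIV. (u - l) \<bullet> axis k 1)"
  proof -
    have "(\<Prod>k\<in>UNIV. (u - l) \<bullet> axis k 1) = (\<Prod>k\<in>{1,2,3}. u $ k - l $ k)"
      by (simp only: UNIV_3) (simp add: inner_axis)
    then show ?thesis using assms by auto
  qed
  also have "\<dots> = (\<Prod>b\<in>Basis. (u - l) \<bullet> b)"
  proof -
    have B: "Basis = range (\<lambda>k. axis k (1::real) :: real^3)" by (auto simp: Basis_vec_def)
    have "inj (\<lambda>k. axis k (1::real) :: real^3)" by (auto simp: inj_def axis_eq_axis)
    then show ?thesis unfolding B by (subst prod.reindex) auto
  qed
  finally show "emeasure (distr lborel borel (vec3 i j)) (box l u) = ennreal (\<Prod>b\<in>Basis. (u - l) \<bullet> b)" .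
qed simp

lemma power_exp_tendsto: "((\<lambda>z. (z\<^sup>2 + 2 * z + 2) * exp (- z)) \<longlongrightarrow> 0) (at_top :: real filter)"
proof -
  have "((\<lambda>z::real. z^2 / exp z + 2 * (z^1 / exp z) + 2 * (z^0 / exp z)) \<longlongrightarrow> 0 + 2 * 0 + 2 * 0) at_top"
    by (intro tendsto_intros tendsto_power_div_exp_0)
  moreover have "(\<lambda>z::real. z^2 / exp z + 2 * (z^1 / exp z) + 2 * (z^0 / exp z)) = (\<lambda>z. (z\<^sup>2 + 2 * z + 2) * exp (- z))"
    by (auto simp: exp_minus field_simps)
  ultimately show ?thesis by simp
qed

lemma integrable_sq_exp: "integrable lborel (\<lambda>z. indicator {0..} z * (z\<^sup>2 * exp (- z)) :: real)"
proof -
  have d: "((\<lambda>z. - ((z\<^sup>2 + 2 * z + 2) * exp (- z))) has_real_derivative z\<^sup>2 * exp (- z)) (at z)" for z :: real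
    by (auto intro!: derivative_eq_intros simp: algebra_simps power2_eq_square)
  have "(\<integral>\<^sup>+ z. ennreal (z\<^sup>2 * exp (- z)) * indicator {0..} z \<partial>lborel) = ennreal (0 - (- ((0\<^sup>2 + 2 * 0 + 2) * exp (- (0::real)))))"
    using tendsto_minus[OF power_exp_tendsto]
    by (intro nn_integral_FTC_atLeast d) auto
  also have "\<dots> < \<infinity>" by simp
  finally have "(\<integral>\<^sup>+ z. ennreal (z\<^sup>2 * exp (- z)) * indicator {0..} z \<partial>lborel) < \<infinity>" .
  moreover have "ennreal (norm (indicator {0..} z * (z\<^sup>2 * exp (- z)))) = ennreal (z\<^sup>2 * exp (- z)) * indicator {0..} z" for z :: real
    by (auto simp: indicator_def)
  ultimately show ?thesis
    by (intro integrableI_bounded) auto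
qed

text \<open>This is the real part of \<open>\<integral> z\<^sup>2 exp(-s z) dz = 2 / s\<^sup>3\<close> over the half-line, with \<open>s = 1 - \<i> u\<close>.\<close>

lemma integral_sq_exp_cos:
  fixes u :: real
  shows "(\<integral>z. indicator {0..} z * (z\<^sup>2 * exp (- z) * cos (z * u)) \<partial>lborel) = 2 * (1 - 3 * u\<^sup>2) / (1 + u\<^sup>2) ^ 3"
proof -
  define s :: complex where "s = Complex 1 (- u)"
  have s: "s \<noteq> 0" "Re s = 1" by (auto simp: s_def complex_eq_iff)
  have s1: "1 \<le> norm s" using abs_Re_le_cmod[of s] s by simp
  define f :: "real \<Rightarrow> complex" where "f z = of_real (z\<^sup>2) * exp (- (s * of_real z))" for z
  define F :: "real \<Rightarrow> complex" where
    "F z = - ((of_real (z\<^sup>2) / s + 2 * of_real z / s\<^sup>2 + 2 / s ^ 3) * exp (- (s * of_real z)))" for z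
  have F: "(F has_vector_derivative f z) (at z)" for z
  proof -
    have "((\<lambda>w. - ((w\<^sup>2 / s + 2 * w / s\<^sup>2 + 2 / s ^ 3) * exp (- (s * w)))) has_field_derivative
        (of_real (z\<^sup>2) * exp (- (s * of_real z)))) (at (of_real z))"
      using s by (auto intro!: derivative_eq_intros simp: field_simps power2_eq_square power3_eq_cube)
    from has_vector_derivative_real_field[OF this]
    show ?thesis by (simp add: F_def[abs_def] f_def)
  qed
  have nf: "norm (f z) = z\<^sup>2 * exp (- z)" for z
    by (simp add: f_def norm_mult norm_power s)
  have f_int: "integrable lborel (\<lambda>z. indicator {0..} z *\<^sub>R f z)"
  proof (rule Bochner_Integration.integrable_bound[OF integrable_sq_exp])
    show "(\<lambda>z. indicator {0..} z *\<^sub>R f z) \<in> borel_measurable lborel"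
      unfolding f_def by measurable
  qed (auto simp: nf indicator_def)
  have "(\<integral>z. indicator {0..} z *\<^sub>R f z \<partial>lborel) = 0 - F 0"
  proof (rule LIMSEQ_unique)
    show "(\<lambda>n. \<integral>z. indicator {0..real n} z *\<^sub>R f z \<partial>lborel) \<longlonglongrightarrow> (\<integral>z. indicator {0..} z *\<^sub>R f z \<partial>lborel)"
    proof (rule integral_dominated_convergence[where w = "\<lambda>z. norm (indicator {0..} z *\<^sub>R f z)"])
      show "AE z in lborel. (\<lambda>n. indicator {0..real n} z *\<^sub>R f z) \<longlonglongrightarrow> indicator {0..} z *\<^sub>R f z"
      proof (rule AE_I2)
        fix z :: real
        have "eventually (\<lambda>n. indicator {0..real n} z *\<^sub>R f z = indicator {0..} z *\<^sub>R f z) sequentially"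
          using eventually_ge_at_top[of "nat \<lceil>z\<rceil>"]
          by eventually_elim (auto simp: indicator_def nat_ceiling_le_eq)
        then show "(\<lambda>n. indicator {0..real n} z *\<^sub>R f z) \<longlonglongrightarrow> indicator {0..} z *\<^sub>R f z"
          by (rule tendsto_eventually)
      qed
      show "integrable lborel (\<lambda>z. norm (indicator {0..} z *\<^sub>R f z))"
        using f_int by (rule integrable_norm)
      show "(\<lambda>z. indicator {0..real n} z *\<^sub>R f z) \<in> borel_measurable lborel" for n
        unfolding f_def by measurable
    qed (use f_int in \<open>auto simp: indicator_def\<close>)
    have "(\<integral>z. indicator {0..real n} z *\<^sub>R f z \<partial>lborel) = F n - F 0" for n
      by (intro integral_FTC_atLeastAtMost has_vector_derivative_at_within[OF F])
        (auto simp: f_def[abs_def] intro!: continuous_intros)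
    moreover have "(\<lambda>n. F (real n) - F 0) \<longlonglongrightarrow> 0 - F 0"
    proof (intro tendsto_diff tendsto_const)
      have "(F \<longlongrightarrow> 0) at_top"
      proof (rule Lim_null_comparison[OF _ power_exp_tendsto])
        have "norm (F z) \<le> (z\<^sup>2 + 2 * z + 2) * exp (- z)" if "z \<ge> 0" for z
        proof -
          have p: "1 \<le> norm s ^ k" for k using s1 by simp
          have dv: "a / b \<le> a" if "0 \<le> a" "1 \<le> b" for a b :: real
            using that mult_left_mono[of 1 b a] by (simp add: pos_divide_le_eq)
          have "norm (of_real (z\<^sup>2) / s + 2 * of_real z / s\<^sup>2 + 2 / s ^ 3)
              \<le> norm (of_real (z\<^sup>2) / s) + norm (2 * of_real z / s\<^sup>2) + norm (2 / s ^ 3)"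
            by (meson add_mono norm_triangle_ineq norm_triangle_mono order_refl)
          also have "\<dots> \<le> z\<^sup>2 + 2 * z + 2"
            using that dv[OF _ p[of 1]] dv[OF _ p[of 2]] dv[OF _ p[of 3]]
            by (intro add_mono) (auto simp: norm_divide norm_mult norm_power)
          finally show ?thesis by (simp add: F_def norm_mult s)
        qed
        then show "eventually (\<lambda>z. norm (F z) \<le> (z\<^sup>2 + 2 * z + 2) * exp (- z)) at_top"
          by (intro eventually_mono[OF eventually_ge_at_top[of 0]])
      qed
      then show "(\<lambda>n. F (real n)) \<longlonglongrightarrow> 0"
        using filterlim_compose filterlim_real_sequentially by blast
    qed
    ultimately show "(\<lambda>n. \<integral>z. indicator {0..real n} z *\<^sub>R f z \<partial>lborel) \<longlonglongrightarrow> 0 - F 0" by simp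
  qed
  then have r1: "Re (\<integral>z. indicator {0..} z *\<^sub>R f z \<partial>lborel) = Re (2 / s ^ 3)"
    by (simp add: F_def)
  have r2: "Re (\<integral>z. indicator {0..} z *\<^sub>R f z \<partial>lborel) = (\<integral>z. Re (indicator {0..} z *\<^sub>R f z) \<partial>lborel)"
    by (rule integral_Re[OF f_int, symmetric])
  have r3: "Re (indicator {0..} z *\<^sub>R f z) = indicator {0..} z * (z\<^sup>2 * exp (- z) * cos (z * u))" for z
    by (simp add: f_def s_def Re_exp mult.commute flip: of_real_power)
  have r4: "Re (2 / s ^ 3) = 2 * (1 - 3 * u\<^sup>2) / (1 + u\<^sup>2) ^ 3"
  proof -
    have "s * cnj s = of_real (1 + u\<^sup>2)"
      by (simp add: s_def complex_eq_iff power2_eq_square)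
    then have "2 / s ^ 3 = 2 * cnj s ^ 3 / of_real (1 + u\<^sup>2) ^ 3"
      using s by (metis (no_types, lifting) complex_cnj_zero_iff mult_divide_mult_cancel_right power_mult_distrib power_not_zero)
    also have "\<dots> = (2 * cnj s ^ 3) / of_real ((1 + u\<^sup>2) ^ 3)" by simp
    also have "Re \<dots> = Re (2 * cnj s ^ 3) / (1 + u\<^sup>2) ^ 3" by (rule Re_divide_of_real)
    also have "Re (2 * cnj s ^ 3) = 2 * (1 - 3 * u\<^sup>2)"
      by (simp add: s_def power3_eq_cube power2_eq_square algebra_simps)
    finally show ?thesis .
  qed
  from r1 r2 r4 show ?thesis unfolding r3 by argo
qed

text \<open>The integrand changes sign, so positivity of the result is only visible after integrating. With
\<open>s\<^sup>2 = 1 + t\<^sup>2\<close>, an ansatz \<open>\<beta> arcsin(g) + p(u) \<surd>(t\<^sup>2 - u\<^sup>2) / (1 + u\<^sup>2)\<^sup>2\<close> with an odd cubic \<open>p\<close> is an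
antiderivative: comparing the coefficients of the even powers of \<open>u\<close> determines \<open>\<beta>\<close> and \<open>p\<close>. The arcsine, rather than
the arctangent of \<open>u s / \<surd>(t\<^sup>2 - u\<^sup>2)\<close>, is used because it stays continuous at the end points, where
it supplies the factor \<open>\<pi>\<close>.\<close>

lemma disc_kernel_has_integral:
  fixes t :: real
  assumes t: "0 < t"
  shows "((\<lambda>u. 2 * (1 - 3 * u\<^sup>2) / (1 + u\<^sup>2) ^ 3 * (2 * sqrt (t\<^sup>2 - u\<^sup>2)))
     has_integral 2 * pi * t\<^sup>2 / sqrt (1 + t\<^sup>2) ^ 3) {- t..t}"
proof -
  define s where "s = sqrt (1 + t\<^sup>2)"
  have s: "0 < s" "s\<^sup>2 = 1 + t\<^sup>2" by (auto simp: s_def add_pos_nonneg)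
  define g where "g u = u * s / (t * sqrt (1 + u\<^sup>2))" for u
  define A where "A u = 4 * (t\<^sup>2 / (2 * s ^ 3) * arcsin (g u)
      + ((1 - 1 / (2 * s\<^sup>2)) * u - 1 / (2 * s\<^sup>2) * u ^ 3) * sqrt (t\<^sup>2 - u\<^sup>2) / (1 + u\<^sup>2)\<^sup>2)" for u
  have r: "0 < sqrt (1 + u\<^sup>2)" "sqrt (1 + u\<^sup>2) ^ 2 = 1 + u\<^sup>2" "1 + u\<^sup>2 \<noteq> 0" for u :: real
    by (auto simp: add_pos_nonneg add_nonneg_eq_0_iff)
  have g2: "1 - (g u)\<^sup>2 = (t\<^sup>2 - u\<^sup>2) / (t * sqrt (1 + u\<^sup>2))\<^sup>2" for u
  proof -
    have "t\<^sup>2 * (1 + u\<^sup>2) \<noteq> 0" using t r(3)[of u] by simp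
    then have "1 - u\<^sup>2 * (1 + t\<^sup>2) / (t\<^sup>2 * (1 + u\<^sup>2)) = (t\<^sup>2 * (1 + u\<^sup>2) - u\<^sup>2 * (1 + t\<^sup>2)) / (t\<^sup>2 * (1 + u\<^sup>2))"
      by (simp add: diff_divide_distrib)
    then show ?thesis
      unfolding g_def power_divide power_mult_distrib r(2) s(2) by (simp add: algebra_simps)
  qed
  have g1: "-1 \<le> g u \<and> g u \<le> 1" if "u \<in> {-t..t}" for u
  proof -
    have "u\<^sup>2 \<le> t\<^sup>2" using that by (metis abs_le_iff abs_le_square_iff abs_of_pos atLeastAtMost_iff minus_le_iff t)
    then have "0 \<le> 1 - (g u)\<^sup>2" unfolding g2 by simp
    then show ?thesis by (simp add: abs_square_le_1 abs_le_iff)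
  qed
  have "((\<lambda>u. 2 * (1 - 3 * u\<^sup>2) / (1 + u\<^sup>2) ^ 3 * (2 * sqrt (t\<^sup>2 - u\<^sup>2)))
     has_integral A t - A (- t)) {- t..t}"
  proof (rule fundamental_theorem_of_calculus_interior)
    show "continuous_on {-t..t} A"
      unfolding A_def using g1 r t s
      by (intro continuous_intros) (auto simp: g_def intro!: continuous_intros)
    fix u assume u: "u \<in> {-t<..<t}"
    define w where "w = sqrt (t\<^sup>2 - u\<^sup>2)"
    define q where "q = sqrt (1 + u\<^sup>2)"
    have "u\<^sup>2 < t\<^sup>2" using u t by (metis abs_less_iff abs_of_pos greaterThanLessThan_iff minus_less_iff power2_abs power_strict_mono abs_ge_zero pos2)
    then have w: "0 < w" "w\<^sup>2 = t\<^sup>2 - u\<^sup>2" by (auto simp: w_def)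
    have q: "0 < q" "q\<^sup>2 = 1 + u\<^sup>2" using r by (auto simp: q_def)
    have dq: "((\<lambda>u. sqrt (1 + u\<^sup>2)) has_real_derivative u / q) (at u)"
    proof -
      have "0 < 1 + u\<^sup>2" by (simp add: add_pos_nonneg)
      then show ?thesis by (auto intro!: derivative_eq_intros simp: q_def field_simps)
    qed
    have dw: "((\<lambda>u. sqrt (t\<^sup>2 - u\<^sup>2)) has_real_derivative - u / w) (at u)"
      using w by (auto intro!: derivative_eq_intros simp: w_def field_simps)
    have "(g has_real_derivative (s * (t * q) - u * s * (t * (u / q))) / ((t * q) * (t * q))) (at u)"
    proof -
      have "((\<lambda>u. u * s) has_real_derivative s) (at u)" by (auto intro!: derivative_eq_intros)
      from DERIV_divide[OF this DERIV_cmult[OF dq, of t]] show ?thesis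
        using q t unfolding g_def by (simp add: q_def)
    qed
    also have "(s * (t * q) - u * s * (t * (u / q))) / ((t * q) * (t * q)) = s / (t * q ^ 3) * (q\<^sup>2 - u\<^sup>2)"
      using q(1) t by (simp add: field_simps power2_eq_square power3_eq_cube)
    also have "\<dots> = s / (t * q ^ 3)" by (simp add: q)
    finally have dg: "(g has_real_derivative s / (t * q ^ 3)) (at u)" .
    \<comment> \<open>The root in the derivative of the arcsine is explicit, and the powers of \<open>q\<close> cancel.\<close>
    have gu: "1 - (g u)\<^sup>2 = (w / (t * q))\<^sup>2"
      unfolding g2 by (simp add: w q_def power_divide)
    then have "0 < 1 - (g u)\<^sup>2" using w q t by simp
    then have g11: "-1 < g u" "g u < 1" by (simp_all add: abs_square_less_1 abs_less_iff)
    have "((\<lambda>u. arcsin (g u)) has_real_derivative inverse (sqrt (1 - (g u)\<^sup>2)) * (s / (t * q ^ 3))) (at u)"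
      by (rule DERIV_chain2[OF DERIV_arcsin[OF g11] dg])
    also have "inverse (sqrt (1 - (g u)\<^sup>2)) * (s / (t * q ^ 3)) = s / (w * q\<^sup>2)"
    proof -
      have "sqrt (1 - (g u)\<^sup>2) = w / (t * q)" unfolding gu using w q t by simp
      then show ?thesis using w q t by (simp add: field_simps power2_eq_square power3_eq_cube)
    qed
    finally have da: "((\<lambda>u. arcsin (g u)) has_real_derivative s / (w * (1 + u\<^sup>2))) (at u)"
      by (simp add: q)
    define P where "P = (1 - 1 / (2 * s\<^sup>2)) * u - 1 / (2 * s\<^sup>2) * u ^ 3"
    define P' where "P' = (1 - 1 / (2 * s\<^sup>2)) - 3 / (2 * s\<^sup>2) * u\<^sup>2"
    have dP: "((\<lambda>u. (1 - 1 / (2 * s\<^sup>2)) * u - 1 / (2 * s\<^sup>2) * u ^ 3) has_real_derivative P') (at u)"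
    proof -
      have "((\<lambda>u. (1 - k) * u - k * u ^ 3) has_real_derivative (1 - k) - 3 * k * u\<^sup>2) (at u)" for k
        by (auto intro!: derivative_eq_intros)
      from this[of "1 / (2 * s\<^sup>2)"] show ?thesis by (simp add: P'_def)
    qed
    have dd: "((\<lambda>u. (1 + u\<^sup>2)\<^sup>2) has_real_derivative 4 * u * (1 + u\<^sup>2)) (at u)"
      by (auto intro!: derivative_eq_intros)
    have dA: "(A has_real_derivative 4 * (t\<^sup>2 / (2 * s ^ 3) * (s / (w * (1 + u\<^sup>2)))
       + ((P' * w + (- u / w) * P) * (1 + u\<^sup>2)\<^sup>2 - P * w * (4 * u * (1 + u\<^sup>2))) / ((1 + u\<^sup>2)\<^sup>2 * (1 + u\<^sup>2)\<^sup>2))) (at u)"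
      unfolding A_def P_def w_def
      by (intro DERIV_cmult DERIV_add da[unfolded w_def] DERIV_divide DERIV_mult dP dw[unfolded w_def] dd)
        (simp add: r)
    define D where "D = 1 + u\<^sup>2"
    have D: "D \<noteq> 0" "u\<^sup>2 = D - 1" using r(3) by (auto simp: D_def)
    have "4 * (t\<^sup>2 / (2 * s ^ 3) * (s / (w * (1 + u\<^sup>2)))
       + ((P' * w + (- u / w) * P) * (1 + u\<^sup>2)\<^sup>2 - P * w * (4 * u * (1 + u\<^sup>2))) / ((1 + u\<^sup>2)\<^sup>2 * (1 + u\<^sup>2)\<^sup>2))
      = 4 * (t\<^sup>2 / (2 * s\<^sup>2) * D\<^sup>2 + (P' * w\<^sup>2 - u * P) * D - 4 * u * P * w\<^sup>2) / (w * D ^ 3)"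
      unfolding D_def[symmetric] using s(1) w(1) D(1)
      by (simp add: field_simps power2_eq_square power3_eq_cube)
    also have "t\<^sup>2 / (2 * s\<^sup>2) * D\<^sup>2 + (P' * w\<^sup>2 - u * P) * D - 4 * u * P * w\<^sup>2 = w\<^sup>2 * (1 - 3 * u\<^sup>2)"
    proof -
      define k where "k = 1 / (2 * s\<^sup>2)"
      \<comment> \<open>The relation between \<open>k\<close> and \<open>t\<close> is all that the comparison of coefficients uses.\<close>
      have k: "k * (2 * (1 + t\<^sup>2)) = 1" using s by (simp add: k_def add_nonneg_eq_0_iff)
      have "t\<^sup>2 * k * (1 + u\<^sup>2)\<^sup>2 + (((1 - k) - 3 * k * u\<^sup>2) * (t\<^sup>2 - u\<^sup>2) - u * ((1 - k) * u - k * u ^ 3)) * (1 + u\<^sup>2)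
          - 4 * u * ((1 - k) * u - k * u ^ 3) * (t\<^sup>2 - u\<^sup>2) = (t\<^sup>2 - u\<^sup>2) * (1 - 3 * u\<^sup>2)"
        using k by algebra
      then show ?thesis
        unfolding P_def P'_def D_def w(2) by (simp add: k_def)
    qed
    also have "4 * (w\<^sup>2 * (1 - 3 * u\<^sup>2)) / (w * D ^ 3) = 2 * (1 - 3 * u\<^sup>2) / (1 + u\<^sup>2) ^ 3 * (2 * sqrt (t\<^sup>2 - u\<^sup>2))"
      using w(1) D(1) unfolding w_def[symmetric] D_def[symmetric]
      by (simp add: field_simps power2_eq_square)
    finally show "(A has_vector_derivative 2 * (1 - 3 * u\<^sup>2) / (1 + u\<^sup>2) ^ 3 * (2 * sqrt (t\<^sup>2 - u\<^sup>2))) (at u)"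
      using dA has_real_derivative_iff_has_vector_derivative by metis
  qed (use t in auto)
  moreover have "g t = 1" "g (- t) = - 1"
    using t s by (auto simp: g_def s_def)
  then have "A t - A (- t) = 2 * pi * t\<^sup>2 / s ^ 3"
    by (simp add: A_def field_simps)
  ultimately show ?thesis by (simp add: s_def)
qed

context
  fixes t :: real and c :: "real \<Rightarrow> real"
  assumes t: "0 < t" and c[measurable]: "c \<in> borel_measurable borel" and c1: "\<And>x. \<bar>c x\<bar> \<le> 1"
begin

private definition "D = {p :: real \<times> real. (fst p)\<^sup>2 + (snd p)\<^sup>2 < t\<^sup>2}"

private lemma D_meas[measurable]: "D \<in> sets borel"
  unfolding D_def by (intro borel_open open_Collect_less continuous_intros)

private lemma D_int: "integrable lborel (indicat_real D)"
proof -
  have "D \<subseteq> cbox (- t, - t) (t, t)"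
  proof
    fix p assume "p \<in> D"
    then have "(fst p)\<^sup>2 < t\<^sup>2" "(snd p)\<^sup>2 < t\<^sup>2"
      unfolding D_def by (smt (verit) mem_Collect_eq zero_le_power2)+
    then have "\<bar>fst p\<bar> < t" "\<bar>snd p\<bar> < t" using t
      by (metis abs_of_pos abs_le_square_iff linorder_not_less)+
    then show "p \<in> cbox (- t, - t) (t, t)" by (cases p) (auto simp: cbox_Pair_eq)
  qed
  then have "emeasure lborel D < \<infinity>"
    by (meson bounded_cbox bounded_subset emeasure_bounded_finite)
  then show ?thesis by (simp add: integrable_indicator_iff)
qed

text \<open>Rescaling a horizontal slice to the fixed disc \<open>D\<close> produces the Jacobian \<open>z\<^sup>2\<close> and makes the domain of
integration a product, so that the order of integration can be exchanged.\<close>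

private lemma slice_integrals:
  assumes b[measurable]: "b \<in> borel_measurable borel" and b1: "\<And>x. \<bar>b x\<bar> \<le> (1::real)"
  shows "(\<integral>p. indicator {0<..} z * indicator D ((1 / z) *\<^sub>R p) * exp (- z) * b (fst p) \<partial>lborel)
    = (\<integral>p. indicator {0..} z * (z\<^sup>2 * exp (- z) * b (z * fst p)) * indicator D p \<partial>lborel)"
proof (cases "z > 0")
  case True
  have "(\<integral>p. indicator {0<..} z * indicator D ((1 / z) *\<^sub>R p) * exp (- z) * b (fst p) \<partial>lborel)
    = z ^ DIM(real \<times> real) *\<^sub>R (\<integral>p. indicator {0<..} z * indicator D ((1 / z) *\<^sub>R (z *\<^sub>R p)) * exp (- z) * b (fst (z *\<^sub>R p)) \<partial>lborel)"
  proof (intro lborel_integral_scale True borel_measurable_times borel_measurable_const)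
    have "(\<lambda>p :: real \<times> real. (1 / z) *\<^sub>R p) \<in> borel_measurable borel" by measurable
    then show "(\<lambda>p. indicat_real D ((1 / z) *\<^sub>R p)) \<in> borel_measurable borel"
      using measurable_compose borel_measurable_indicator[OF D_meas] by blast
    have "(fst :: real \<times> real \<Rightarrow> real) \<in> borel_measurable borel"
      by (intro borel_measurable_continuous_onI continuous_intros)
    then show "(\<lambda>p :: real \<times> real. b (fst p)) \<in> borel_measurable borel"
      using b by (rule measurable_compose)
  qed
  also have "\<dots> = (\<integral>p. z ^ DIM(real \<times> real) *\<^sub>R (indicator {0<..} z * indicator D ((1 / z) *\<^sub>R (z *\<^sub>R p)) * exp (- z) * b (fst (z *\<^sub>R p))) \<partial>lborel)"
    by (rule integral_scaleR_right[symmetric])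
  also have "\<dots> = (\<integral>p. indicator {0..} z * (z\<^sup>2 * exp (- z) * b (z * fst p)) * indicator D p \<partial>lborel)"
    using True by (intro Bochner_Integration.integral_cong) (auto simp: indicator_def power2_eq_square)
  finally show ?thesis .
next
  case False
  then show ?thesis by (cases "z = 0") (auto simp: indicator_def)
qed

private lemma Phi_integrable:
  "integrable lborel (\<lambda>(z, p). indicator {0<..} z * indicator D ((1 / z) *\<^sub>R p) * exp (- z) * c (fst p))"
  and Psi_integrable:
  "integrable lborel (\<lambda>(z, p). indicator {0..} z * (z\<^sup>2 * exp (- z) * c (z * fst p)) * indicator D p)"
proof -
  have m[measurable]: "(\<lambda>(z, p). indicator {0<..} z * indicat_real D ((1 / z) *\<^sub>R p) * exp (- z))
      \<in> borel_measurable (lborel \<Otimes>\<^sub>M lborel)"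
    by measurable
  have m': "(\<lambda>(z, p). indicator {0..} z * (z\<^sup>2 * exp (- z)) * indicat_real D p)
      \<in> borel_measurable (lborel \<Otimes>\<^sub>M lborel)"
    by measurable
  have eq: "(\<integral>p. indicator {0<..} z * indicator D ((1 / z) *\<^sub>R p) * exp (- z) \<partial>lborel)
    = indicator {0..} z * (z\<^sup>2 * exp (- z)) * (\<integral>p. indicat_real D p \<partial>lborel)" for z :: real
    using slice_integrals[of "\<lambda>_. 1" z] by simp
  have 1: "integrable lborel (\<lambda>z. indicator {0..} z * (z\<^sup>2 * exp (- z)) * (\<integral>p. indicat_real D p \<partial>lborel))"
    by (intro integrable_mult_left integrable_sq_exp)
  have "integrable (lborel \<Otimes>\<^sub>M lborel) (\<lambda>(z, p). indicator {0<..} z * indicat_real D ((1 / z) *\<^sub>R p) * exp (- z))"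
  proof (rule lborel_pair.Fubini_integrable[OF m])
    show "integrable lborel (\<lambda>z. \<integral>p. norm (case (z, p) of (z, p) \<Rightarrow>
       indicator {0<..} z * indicat_real D ((1 / z) *\<^sub>R p) * exp (- z)) \<partial>lborel)"
    proof -
      have "(\<integral>p. norm (case (z, p) of (z, p) \<Rightarrow>
          indicator {0<..} z * indicat_real D ((1 / z) *\<^sub>R p) * exp (- z)) \<partial>lborel)
        = indicator {0..} z * (z\<^sup>2 * exp (- z)) * (\<integral>p. indicat_real D p \<partial>lborel)" for z :: real
        unfolding eq[symmetric] by (simp add: abs_mult)
      with 1 show ?thesis by (simp only:)
    qed
    show "AE z in lborel. integrable lborel (\<lambda>p. case (z, p) of (z, p) \<Rightarrow>
       indicator {0<..} z * indicat_real D ((1 / z) *\<^sub>R p) * exp (- z))"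
    proof (rule AE_I2)
      fix z :: real
      show "integrable lborel (\<lambda>p. case (z, p) of (z, p) \<Rightarrow>
       indicator {0<..} z * indicat_real D ((1 / z) *\<^sub>R p) * exp (- z))"
      proof (cases "z > 0")
        case True
        then show ?thesis
          using lborel_integrable_scale[OF D_int, of "1 / z"] by simp
      qed simp
    qed
  qed
  then have 2: "integrable lborel (\<lambda>(z, p). indicator {0<..} z * indicat_real D ((1 / z) *\<^sub>R p) * exp (- z))"
    by (simp add: lborel_prod)
  have "(\<lambda>q :: real \<times> real \<times> real. fst q * fst (snd q)) \<in> borel_measurable borel"
    "(\<lambda>q :: real \<times> real \<times> real. fst (snd q)) \<in> borel_measurable borel"
    by (intro borel_measurable_continuous_onI continuous_intros)+
  from this[THEN measurable_compose, OF c]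
  have k1: "(\<lambda>q :: real \<times> real \<times> real. c (fst q * fst (snd q))) \<in> borel_measurable (lborel \<Otimes>\<^sub>M lborel)"
    and k2: "(\<lambda>q :: real \<times> real \<times> real. c (fst (snd q))) \<in> borel_measurable (lborel \<Otimes>\<^sub>M lborel)"
    by (simp_all add: lborel_prod)
  have mc: "(\<lambda>(z, p). indicator {0<..} z * indicator D ((1 / z) *\<^sub>R p) * exp (- z) * c (fst p))
      \<in> borel_measurable (lborel \<Otimes>\<^sub>M lborel)"
     "(\<lambda>(z, p). indicator {0..} z * (z\<^sup>2 * exp (- z) * c (z * fst p)) * indicator D p)
      \<in> borel_measurable (lborel \<Otimes>\<^sub>M lborel)"
    using borel_measurable_times[OF m k2] borel_measurable_times[OF m' k1]
    by (simp_all add: case_prod_beta mult_ac)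
  show "integrable lborel (\<lambda>(z, p). indicator {0<..} z * indicator D ((1 / z) *\<^sub>R p) * exp (- z) * c (fst p))"
  proof (rule Bochner_Integration.integrable_bound[OF 2])
    show "AE x in lborel. norm (case x of (z, p) \<Rightarrow> indicator {0<..} z * indicator D ((1 / z) *\<^sub>R p) * exp (- z) * c (fst p))
       \<le> norm (case x of (z, p) \<Rightarrow> indicator {0<..} z * indicat_real D ((1 / z) *\<^sub>R p) * exp (- z))"
      using c1 by (auto simp: abs_mult split: prod.splits intro!: AE_I2 mult_left_le)
  qed (use mc in \<open>simp add: lborel_prod\<close>)
  have "integrable (lborel \<Otimes>\<^sub>M lborel) (\<lambda>(z, p). indicator {0..} z * (z\<^sup>2 * exp (- z)) * indicat_real D p)"
    by (rule lborel_pair.Fubini_integrable[OF m']) (use 1 D_int in \<open>auto simp: abs_mult mult.assoc\<close>)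
  then have 3: "integrable lborel (\<lambda>(z, p). indicator {0..} z * (z\<^sup>2 * exp (- z)) * indicat_real D p)"
    by (simp add: lborel_prod)
  show "integrable lborel (\<lambda>(z, p). indicator {0..} z * (z\<^sup>2 * exp (- z) * c (z * fst p)) * indicator D p)"
  proof (rule Bochner_Integration.integrable_bound[OF 3])
    show "AE x in lborel. norm (case x of (z, p) \<Rightarrow> indicator {0..} z * (z\<^sup>2 * exp (- z) * c (z * fst p)) * indicator D p)
       \<le> norm (case x of (z, p) \<Rightarrow> indicator {0..} z * (z\<^sup>2 * exp (- z)) * indicat_real D p)"
      using c1 by (auto simp: abs_mult indicator_def split: prod.splits intro!: AE_I2 mult_left_le)
  qed (use mc in \<open>simp add: lborel_prod\<close>)
qed

private lemma cone_vec3: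
  fixes i j :: 3
  assumes "0 \<le> \<theta>" "\<theta> < pi / 2" "t = tan \<theta>" "(i, j) \<in> {(1, 2), (2, 1)}"
  shows "indicat_real (cone \<theta>) (vec3 i j (z, p)) = indicator {0<..} z * indicator D ((1 / z) *\<^sub>R p)"
proof -
  have "(vec3 i j (z, p) $ 1)\<^sup>2 + (vec3 i j (z, p) $ 2)\<^sup>2 = (fst p)\<^sup>2 + (snd p)\<^sup>2" "vec3 i j (z, p) $ 3 = z"
    using assms(4) by (auto simp: vec3_def split: prod.splits)
  then have "vec3 i j (z, p) \<in> cone \<theta> \<longleftrightarrow> 0 < z \<and> (fst p)\<^sup>2 + (snd p)\<^sup>2 < (t * z)\<^sup>2"
    using cone_iff[OF assms(1,2)] assms(3) by simp
  also have "\<dots> \<longleftrightarrow> 0 < z \<and> (1 / z) *\<^sub>R p \<in> D"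
    by (auto simp: D_def power_divide power_mult_distrib field_simps)
  finally show ?thesis by (auto simp: indicator_def)
qed

text \<open>The weight \<open>c\<close> is the constant one (for integrability of the exponential) or the cosine (for the Laplace
transform). On the right-hand side, \<open>u\<close> is the slope \<open>x\<^sub>i / x\<^sub>3\<close>, and the square root is half the length of the chord of the disc.\<close>

lemma cone_exp_integrable_and_integral:
  fixes i j :: 3
  assumes "0 \<le> \<theta>" "\<theta> < pi / 2" "t = tan \<theta>" "(i, j) \<in> {(1, 2), (2, 1)}"
  shows "integrable lborel (\<lambda>x. indicator (cone \<theta>) x * exp (- x $ 3) * c (x $ i))"
    and "(\<integral>x. indicator (cone \<theta>) x * exp (- x $ 3) * c (x $ i) \<partial>lborel)
      = (\<integral>u. (\<integral>z. indicator {0..} z * (z\<^sup>2 * exp (- z) * c (z * u)) \<partial>lborel)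
              * (indicator {-t..t} u * (2 * sqrt (t\<^sup>2 - u\<^sup>2))) \<partial>lborel)"
proof -
  let ?h = "\<lambda>x. indicator (cone \<theta>) x * exp (- x $ 3) * c (x $ i)"
  have [measurable]: "cone \<theta> \<in> sets borel"
    using open_cone[of \<theta>] assms(1,2) by simp
  have hm[measurable]: "?h \<in> borel_measurable borel" by measurable
  have *: "?h (vec3 i j (z, p)) = indicator {0<..} z * indicator D ((1 / z) *\<^sub>R p) * exp (- z) * c (fst p)" for z p
    unfolding cone_vec3[OF assms] using assms(4) by (auto simp: vec3_def split: prod.splits)
  then have **: "(\<lambda>q. ?h (vec3 i j q)) = (\<lambda>(z, p). indicator {0<..} z * indicator D ((1 / z) *\<^sub>R p) * exp (- z) * c (fst p))"
    by auto
  show "integrable lborel ?h"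
    unfolding lborel_vec3[OF assms(4)]
    by (subst integrable_distr_eq) (simp_all only: ** Phi_integrable, measurable)
  have "(\<integral>x. ?h x \<partial>lborel) = (\<integral>q. ?h (vec3 i j q) \<partial>lborel)"
    by (subst lborel_vec3[OF assms(4)]) (intro integral_distr; measurable)
  also have "\<dots> = (\<integral>z. \<integral>p. indicator {0<..} z * indicator D ((1 / z) *\<^sub>R p) * exp (- z) * c (fst p) \<partial>lborel \<partial>lborel)"
    unfolding ** using lborel_pair.integral_fst'[of "\<lambda>(z, p). indicator {0<..} z * indicator D ((1 / z) *\<^sub>R p) * exp (- z) * c (fst p)"]
      Phi_integrable by (simp add: lborel_prod)
  also have "\<dots> = (\<integral>z. \<integral>p. indicator {0..} z * (z\<^sup>2 * exp (- z) * c (z * fst p)) * indicator D p \<partial>lborel \<partial>lborel)"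
    by (simp only: slice_integrals[OF c c1])
  also have "\<dots> = (\<integral>p. \<integral>z. indicator {0..} z * (z\<^sup>2 * exp (- z) * c (z * fst p)) * indicator D p \<partial>lborel \<partial>lborel)"
    by (rule lborel_pair.Fubini_integral[symmetric]) (use Psi_integrable in \<open>simp add: lborel_prod\<close>)
  also have "\<dots> = (\<integral>p. (\<integral>z. indicator {0..} z * (z\<^sup>2 * exp (- z) * c (z * fst p)) \<partial>lborel) * indicator D p \<partial>lborel)"
    by simp
  also have "\<dots> = (\<integral>u. \<integral>v. (\<integral>z. indicator {0..} z * (z\<^sup>2 * exp (- z) * c (z * u)) \<partial>lborel) * indicator D (u, v) \<partial>lborel \<partial>lborel)"
  proof -
    have "integrable lborel (\<lambda>p. \<integral>z. indicator {0..} z * (z\<^sup>2 * exp (- z) * c (z * fst p)) * indicator D p \<partial>lborel)"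
      by (rule lborel_pair.integrable_snd) (use Psi_integrable in \<open>simp add: lborel_prod\<close>)
    then show ?thesis
      using lborel_pair.integral_fst'[of "\<lambda>p. (\<integral>z. indicator {0..} z * (z\<^sup>2 * exp (- z) * c (z * fst p)) \<partial>lborel) * indicator D p"]
      by (simp add: lborel_prod)
  qed
  also have "\<dots> = (\<integral>u. (\<integral>z. indicator {0..} z * (z\<^sup>2 * exp (- z) * c (z * u)) \<partial>lborel)
              * (indicator {-t..t} u * (2 * sqrt (t\<^sup>2 - u\<^sup>2))) \<partial>lborel)"
  proof -
    have "(\<integral>v. indicat_real D (u, v) \<partial>lborel) = indicator {-t..t} u * (2 * sqrt (t\<^sup>2 - u\<^sup>2))" for u
    proof -
      have ind: "indicat_real D (u, v) = indicator {- sqrt (t\<^sup>2 - u\<^sup>2)<..<sqrt (t\<^sup>2 - u\<^sup>2)} v" for v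
      proof -
        have "u\<^sup>2 + v\<^sup>2 < t\<^sup>2 \<longleftrightarrow> \<bar>v\<bar> < sqrt (t\<^sup>2 - u\<^sup>2)"
          by (metis less_diff_eq add.commute real_sqrt_abs real_sqrt_less_iff)
        then show ?thesis by (auto simp: D_def indicator_def abs_less_iff)
      qed
      show ?thesis
      proof (cases "u \<in> {-t..t}")
        case True
        then have "u\<^sup>2 \<le> t\<^sup>2" using t by (simp add: abs_le_square_iff[symmetric] abs_le_iff)
        with True show ?thesis unfolding ind by simp
      next
        case False
        then have "\<not> u\<^sup>2 \<le> t\<^sup>2" using t by (auto simp: abs_le_square_iff[symmetric] abs_le_iff)
        then have "sqrt (t\<^sup>2 - u\<^sup>2) < 0" by simp
        with False show ?thesis unfolding ind by simp
      qed
    qed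
    then show ?thesis by simp
  qed
  finally show "(\<integral>x. ?h x \<partial>lborel)
      = (\<integral>u. (\<integral>z. indicator {0..} z * (z\<^sup>2 * exp (- z) * c (z * u)) \<partial>lborel)
              * (indicator {-t..t} u * (2 * sqrt (t\<^sup>2 - u\<^sup>2))) \<partial>lborel)" .
qed

end

lemma cone_exp_integrable:
  assumes "0 < \<theta>" "\<theta> < pi / 2"
  shows "integrable lborel (\<lambda>x. indicator (cone \<theta>) x * exp (- x $ 3))"
  using cone_exp_integrable_and_integral(1)[of "tan \<theta>" "\<lambda>_. 1" \<theta> 1 2] assms tan_gt_zero[of \<theta>]
  by simp

lemma cone_exp_cos_integral:
  fixes i :: 3
  assumes "0 < \<theta>" "\<theta> < pi / 2" "i = 1 \<or> i = 2"
  shows "(\<integral>x. indicator (cone \<theta>) x * exp (- x $ 3) * cos (x $ i) \<partial>lborel)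
    = 2 * pi * (tan \<theta>)\<^sup>2 / sqrt (1 + (tan \<theta>)\<^sup>2) ^ 3"
proof -
  define t where "t = tan \<theta>"
  have t: "0 < t" using assms by (simp add: t_def tan_gt_zero)
  have ij: "(i, if i = 1 then 2 else 1) \<in> {(1, 2), (2, 1)}" using assms(3) by auto
  let ?k = "\<lambda>u. 2 * (1 - 3 * u\<^sup>2) / (1 + u\<^sup>2) ^ 3 * (2 * sqrt (t\<^sup>2 - u\<^sup>2))"
  have r: "1 + u\<^sup>2 \<noteq> 0" for u :: real by (auto simp: add_nonneg_eq_0_iff)
  have "(\<integral>x. indicator (cone \<theta>) x * exp (- x $ 3) * cos (x $ i) \<partial>lborel)
    = (\<integral>u. (2 * (1 - 3 * u\<^sup>2) / (1 + u\<^sup>2) ^ 3) * (indicator {-t..t} u * (2 * sqrt (t\<^sup>2 - u\<^sup>2))) \<partial>lborel)"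
    using cone_exp_integrable_and_integral(2)[OF t _ _ _ _ _ ij, of cos \<theta>] assms
    unfolding integral_sq_exp_cos by (simp add: t_def)
  also have "\<dots> = (LINT u:{-t..t}|lborel. ?k u)"
    unfolding set_lebesgue_integral_def by (simp add: mult_ac)
  also have "\<dots> = integral {-t..t} ?k"
    by (intro set_borel_integral_eq_integral borel_integrable_atLeastAtMost') (auto intro!: continuous_intros simp: r)
  also have "\<dots> = 2 * pi * t\<^sup>2 / sqrt (1 + t\<^sup>2) ^ 3"
    using disc_kernel_has_integral[OF t] by (rule integral_unique)
  finally show ?thesis by (simp add: t_def)
qed

lemma lin_3: "lin \<rho> x = \<rho> $ 1 * of_real (x $ 1) + \<rho> $ 2 * of_real (x $ 2) + \<rho> $ 3 * of_real (x $ 3)"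
  by (simp add: lin_def sum_3)

lemma lin_scaleR: "lin \<rho> (c *\<^sub>R x) = of_real c * lin \<rho> x"
  and lin_smult: "lin (z *s \<rho>) x = z * lin \<rho> x"
  by (simp_all add: lin_3 algebra_simps)

lemma continuous_on_lin: "continuous_on S (lin \<rho>)"
  by (intro linear_continuous_on bounded_linear_lin)

lemma lin_measurable[measurable]: "lin \<rho> \<in> borel_measurable borel"
  by (intro borel_measurable_continuous_onI continuous_on_lin)

definition cone_laplace :: "real \<Rightarrow> complex^3 \<Rightarrow> complex" where
  "cone_laplace \<theta> \<rho> = (\<integral>x. indicator (cone \<theta>) x *\<^sub>R exp (lin \<rho> x) \<partial>lborel)"

lemma cone_exp_lin_integrable:
  assumes th: "0 < \<theta>" "\<theta> < pi / 2" and \<rho>: "\<And>x. Re (lin \<rho> x) = - x $ 3"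
  shows "integrable lborel (\<lambda>x. indicator (cone \<theta>) x *\<^sub>R exp (lin \<rho> x))"
proof (rule Bochner_Integration.integrable_bound[OF cone_exp_integrable[OF th]])
  have [measurable]: "cone \<theta> \<in> sets borel" using open_cone[of \<theta>] th by simp
  show "(\<lambda>x. indicator (cone \<theta>) x *\<^sub>R exp (lin \<rho> x)) \<in> borel_measurable lborel"
    by measurable
qed (auto simp: indicator_def \<rho>)

text \<open>The formula is \<open>2\<pi> cos \<theta> sin\<^sup>2 \<theta>\<close>, so the Laplace transform does not vanish at null vectors for a proper convex cone. The
sign \<open>s\<close> is immaterial because the cosine is even.\<close>

lemma Re_cone_laplace:
  assumes th: "0 < \<theta>" "\<theta> < pi / 2" and i: "i = 1 \<or> i = 2" and s: "s = 1 \<or> s = - 1"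
    and \<rho>: "\<And>x. lin \<rho> x = Complex (- x $ 3) (s * x $ i)"
  shows "Re (cone_laplace \<theta> \<rho>) = 2 * pi * (tan \<theta>)\<^sup>2 / sqrt (1 + (tan \<theta>)\<^sup>2) ^ 3"
proof -
  have "integrable lborel (\<lambda>x. indicator (cone \<theta>) x *\<^sub>R exp (lin \<rho> x))"
    by (rule cone_exp_lin_integrable[OF th]) (simp add: \<rho>)
  from integral_Re[OF this]
  have "Re (cone_laplace \<theta> \<rho>) = (\<integral>x. Re (indicator (cone \<theta>) x *\<^sub>R exp (lin \<rho> x)) \<partial>lborel)"
    by (simp add: cone_laplace_def)
  also have "\<dots> = (\<integral>x. indicator (cone \<theta>) x * exp (- x $ 3) * cos (x $ i) \<partial>lborel)"
    using s by (intro Bochner_Integration.integral_cong) (auto simp: \<rho> Re_exp)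
  finally show ?thesis using cone_exp_cos_integral[OF th i] by simp
qed


section \<open>Concentration of plane waves at the apex\<close>

lemma measurable_cdot:
  assumes "f \<in> borel_measurable M" "g \<in> borel_measurable M"
  shows "(\<lambda>x. cdot (f x) (g x)) \<in> borel_measurable M"
proof -
  have nth: "(\<lambda>x. h x $ i) \<in> borel_measurable M" if "h \<in> borel_measurable M" for h :: "'a \<Rightarrow> complex^3" and i
    by (rule borel_measurable_continuous_on[OF _ that]) (intro continuous_intros)
  show ?thesis unfolding cdot_def by (intro borel_measurable_sum borel_measurable_times nth assms)
qed

lemma integrable_cdot_bounded:
  assumes F: "F \<in> L2 K" and K: "K \<in> lmeasurable"
    and w: "w \<in> borel_measurable (lebesgue_on K)" and B: "\<And>x. x \<in> K \<Longrightarrow> norm (w x) \<le> B"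
  shows "integrable (lebesgue_on K) (\<lambda>x. cdot (F x) (w x))"
proof (rule Bochner_Integration.integrable_bound)
  interpret finite_measure "lebesgue_on K" using K by (rule finite_measure_lebesgue_on)
  show "integrable (lebesgue_on K) (\<lambda>x. 3 * B * (1 + (norm (F x))\<^sup>2))"
    using F by (intro integrable_mult_right Bochner_Integration.integrable_add) (auto simp: L2_def)
  have [measurable]: "F \<in> borel_measurable (lebesgue_on K)" using F by (simp add: L2_def)
  show "(\<lambda>x. cdot (F x) (w x)) \<in> borel_measurable (lebesgue_on K)"
    by (intro measurable_cdot w) measurable
  have "norm (cdot (F x) (w x)) \<le> norm (3 * B * (1 + (norm (F x))\<^sup>2))" if "x \<in> K" for x
  proof -
    have B0: "0 \<le> B" using B[OF that] norm_ge_zero order_trans by blast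
    have "norm (cdot (F x) (w x)) \<le> 3 * norm (F x) * norm (w x)" by (rule norm_cdot_le)
    also have "\<dots> \<le> 3 * (1 + (norm (F x))\<^sup>2) * B"
    proof -
      have "0 \<le> (norm (F x) - 1)\<^sup>2" "0 \<le> (norm (F x))\<^sup>2" by simp_all
      then have "norm (F x) \<le> 1 + (norm (F x))\<^sup>2" unfolding power2_diff power_one by linarith
      then show ?thesis using B[OF that] by (intro mult_mono) auto
    qed
    finally show ?thesis using B0 by (simp add: mult_ac)
  qed
  then show "AE x in lebesgue_on K. norm (cdot (F x) (w x)) \<le> norm (3 * B * (1 + (norm (F x))\<^sup>2))"
    by (intro AE_I2) (auto simp: space_restrict_space)
qed

lemma cone_exp_scaled:
  assumes th: "0 < \<theta>" "\<theta> < pi / 2" and \<tau>: "0 < \<tau>"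
  shows "integrable lborel (\<lambda>x. indicator (cone \<theta>) x * exp (- \<tau> * x $ 3))"
    and "(\<integral>x. indicator (cone \<theta>) x * exp (- \<tau> * x $ 3) \<partial>lborel)
       = (\<integral>x. indicator (cone \<theta>) x * exp (- x $ 3) \<partial>lborel) / \<tau> ^ 3"
proof -
  have cs: "\<tau> *\<^sub>R x \<in> cone \<theta> \<longleftrightarrow> x \<in> cone \<theta>" for x
    using th \<tau> by (simp add: cone_iff_norm)
  have [measurable]: "cone \<theta> \<in> sets borel"
    using open_cone[of \<theta>] th by simp
  have eq: "indicator (cone \<theta>) (\<tau> *\<^sub>R x) * exp (- (\<tau> *\<^sub>R x) $ 3) = indicat_real (cone \<theta>) x * exp (- \<tau> * x $ 3)" for x
    by (simp add: indicator_def cs)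
  show "integrable lborel (\<lambda>x. indicator (cone \<theta>) x * exp (- \<tau> * x $ 3))"
    using lborel_integrable_scale[OF cone_exp_integrable[OF th] \<tau>] unfolding eq .
  have "(\<integral>x. indicator (cone \<theta>) x * exp (- x $ 3) \<partial>lborel) = \<tau> ^ 3 * (\<integral>x. indicator (cone \<theta>) x * exp (- \<tau> * x $ 3) \<partial>lborel)"
    using lborel_integral_scale[OF _ \<tau>, of "\<lambda>x. indicator (cone \<theta>) x * exp (- x $ 3)"] unfolding eq by simp
  then show "(\<integral>x. indicator (cone \<theta>) x * exp (- \<tau> * x $ 3) \<partial>lborel)
       = (\<integral>x. indicator (cone \<theta>) x * exp (- x $ 3) \<partial>lborel) / \<tau> ^ 3"
    using \<tau> by simp
qed

lemma exp_on_subset_of_cone: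
  assumes th: "0 < \<theta>" "\<theta> < pi / 2" and \<tau>: "0 < \<tau>" and K: "K \<subseteq> cone \<theta>" "K \<in> sets lebesgue"
  shows "integrable (lebesgue_on K) (\<lambda>x. exp (- \<tau> * x $ 3))"
    and "(\<integral>x. exp (- \<tau> * x $ 3) \<partial>lebesgue_on K)
       \<le> (\<integral>x. indicator (cone \<theta>) x * exp (- x $ 3) \<partial>lborel) / \<tau> ^ 3"
proof -
  let ?f = "\<lambda>x :: real^3. indicator (cone \<theta>) x * exp (- \<tau> * x $ 3)"
  have f: "integrable lborel ?f" by (rule cone_exp_scaled(1)[OF th \<tau>])
  then have fl: "integrable lebesgue ?f" by (simp add: integrable_completion)
  have e: "indicator K x *\<^sub>R ?f x = indicator K x *\<^sub>R exp (- \<tau> * x $ 3)" for x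
    using K by (auto simp: indicator_def)
  have i: "integrable lebesgue (\<lambda>x. indicator K x *\<^sub>R exp (- \<tau> * x $ 3))"
    using integrable_mult_indicator[OF K(2) fl] unfolding e .
  then show "integrable (lebesgue_on K) (\<lambda>x. exp (- \<tau> * x $ 3))"
    using K by (simp add: integrable_restrict_space)
  have "(\<integral>x. exp (- \<tau> * x $ 3) \<partial>lebesgue_on K) = (\<integral>x. indicator K x *\<^sub>R exp (- \<tau> * x $ 3) \<partial>lebesgue)"
    using K by (simp add: integral_restrict_space)
  also have "\<dots> \<le> (\<integral>x. ?f x \<partial>lebesgue)"
    by (rule integral_mono[OF i fl]) (use K in \<open>auto simp: indicator_def\<close>)
  also have "\<dots> = (\<integral>x. ?f x \<partial>lborel)"
    using f by (intro integral_completion) simp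
  finally show "(\<integral>x. exp (- \<tau> * x $ 3) \<partial>lebesgue_on K)
       \<le> (\<integral>x. indicator (cone \<theta>) x * exp (- x $ 3) \<partial>lborel) / \<tau> ^ 3"
    using cone_exp_scaled(2)[OF th \<tau>] by simp
qed

text \<open>Inside the cone \<open>|x|\<close> is controlled by the height, and the height is controlled by half of the exponential decay:
each factor \<open>|x|\<close> is worth \<open>1/\<tau>\<close>.\<close>

lemma norm_power_exp_le:
  assumes th: "0 < \<theta>" "\<theta> < pi / 2" and \<tau>: "0 < \<tau>" and x: "x \<in> cone \<theta>"
  shows "norm x ^ m * exp (- \<tau> * x $ 3) \<le> (2 * real m / cos \<theta>) ^ m / \<tau> ^ m * exp (- (\<tau> / 2) * x $ 3)"
proof -
  have c: "0 < cos \<theta>" using th by (intro cos_gt_zero_pi) auto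
  have n: "norm x \<le> x $ 3 / cos \<theta>" using x th c by (simp add: cone_iff_norm field_simps)
  have x3: "0 \<le> x $ 3" using x th by (simp add: cone_iff)
  have "norm x ^ m * exp (- \<tau> * x $ 3) \<le> (x $ 3 / cos \<theta>) ^ m * exp (- \<tau> * x $ 3)"
    using n by (intro mult_right_mono power_mono) auto
  also have "(x $ 3 / cos \<theta>) ^ m = (2 / (\<tau> * cos \<theta>)) ^ m * (\<tau> / 2 * x $ 3) ^ m"
    using \<tau> by (simp flip: power_mult_distrib)
  also have "\<dots> * exp (- \<tau> * x $ 3) \<le> (2 / (\<tau> * cos \<theta>)) ^ m * (real m ^ m * exp (\<tau> / 2 * x $ 3)) * exp (- \<tau> * x $ 3)"
    using \<tau> c x3 by (intro mult_right_mono mult_left_mono power_le_exp) auto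
  also have "\<dots> = (2 * real m / cos \<theta>) ^ m / \<tau> ^ m * (exp (\<tau> / 2 * x $ 3) * exp (- \<tau> * x $ 3))"
    by (simp add: power_mult_distrib power_divide mult_ac)
  also have "exp (\<tau> / 2 * x $ 3) * exp (- \<tau> * x $ 3) = exp (- (\<tau> / 2) * x $ 3)"
    by (simp flip: exp_add)
  finally show ?thesis .
qed

text \<open>With \<open>\<tau> = T\<^sup>2\<close>, this is the Cauchy-Schwarz estimate \<open>\<parallel>F\<parallel> \<parallel>w\<parallel>\<close>, where \<open>\<parallel>w\<parallel>\<close> is of order
\<open>\<tau>^(-m-3/2)\<close> by scaling. It is obtained from the weighted inequality \<open>2 p q \<le> p\<^sup>2 / T\<^sup>3 + T\<^sup>3 q\<^sup>2\<close>, and the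
frequency is a square so that all exponents are integers.\<close>

lemma L2_pairing_decay:
  assumes th: "0 < \<theta>" "\<theta> < pi / 2" and F: "F \<in> L2 K" and K: "K \<subseteq> cone \<theta>" "K \<in> sets lebesgue"
  obtains C where "\<And>T A w. 0 < T \<Longrightarrow> 0 \<le> A \<Longrightarrow> (\<And>x. x \<in> K \<Longrightarrow> norm (w x) \<le> A * norm x ^ m * exp (- (T\<^sup>2) * x $ 3))
    \<Longrightarrow> integrable (lebesgue_on K) (\<lambda>x. cdot (F x) (w x))
    \<Longrightarrow> norm (\<integral>x. cdot (F x) (w x) \<partial>lebesgue_on K) \<le> C * A / T ^ (2 * m + 3)"
proof -
  define D where "D = (2 * real m / cos \<theta>) ^ m"
  have "0 < cos \<theta>" using th by (intro cos_gt_zero_pi) auto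
  then have D: "0 \<le> D" by (simp add: D_def)
  define I where "I = (\<integral>x. indicator (cone \<theta>) x * exp (- x $ 3) \<partial>lborel)"
  define N where "N = (\<integral>x. (norm (F x))\<^sup>2 \<partial>lebesgue_on K)"
  have Fi: "integrable (lebesgue_on K) (\<lambda>x. (norm (F x))\<^sup>2)" using F by (simp add: L2_def)
  show thesis
  proof (rule that[of "3 * D * (N + I) / 2"])
    fix T A w
    assume T: "0 < (T :: real)" and A: "0 \<le> (A :: real)" and w: "\<And>x. x \<in> K \<Longrightarrow> norm (w x) \<le> A * norm x ^ m * exp (- (T\<^sup>2) * x $ 3)"
      and int: "integrable (lebesgue_on K) (\<lambda>x. cdot (F x) (w x))"
    let ?g = "\<lambda>x. 3 * A * D / T ^ (2 * m) * ((norm (F x))\<^sup>2 / T ^ 3 + T ^ 3 * exp (- T\<^sup>2 * x $ 3)) / 2"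
    note e = exp_on_subset_of_cone[OF th _ K, of "T\<^sup>2"]
    have gi: "integrable (lebesgue_on K) ?g"
      using Fi e(1) T by auto
    have pt: "norm (cdot (F x) (w x)) \<le> ?g x" if x: "x \<in> K" for x
    proof -
      have xc: "x \<in> cone \<theta>" using x K by auto
      have "norm (w x) \<le> A * (norm x ^ m * exp (- (T\<^sup>2) * x $ 3))" using w[OF x] by (simp add: mult.assoc)
      also have "\<dots> \<le> A * (D / (T\<^sup>2) ^ m * exp (- (T\<^sup>2 / 2) * x $ 3))"
        unfolding D_def using T A by (intro mult_left_mono norm_power_exp_le th xc) auto
      finally have w': "norm (w x) \<le> A * D / T ^ (2 * m) * exp (- (T\<^sup>2 / 2) * x $ 3)"
        by (simp add: power_mult)
      have ee: "exp (- (T\<^sup>2 / 2) * x $ 3) ^ 2 = exp (- T\<^sup>2 * x $ 3)"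
        by (simp flip: exp_of_nat_mult)
      have am: "norm (F x) * exp (- (T\<^sup>2 / 2) * x $ 3) \<le> ((norm (F x))\<^sup>2 / T ^ 3 + T ^ 3 * exp (- T\<^sup>2 * x $ 3)) / 2"
      proof -
        define p where "p = norm (F x)"
        define q where "q = exp (- (T\<^sup>2 / 2) * x $ 3)"
        \<comment> \<open>The weight \<open>T\<^sup>3\<close> balances the two terms, because \<open>exp(- T\<^sup>2 x\<^sub>3)\<close> has integral of order \<open>T^(-6)\<close>.\<close>
        have "0 \<le> (p - T ^ 3 * q)\<^sup>2 / T ^ 3" using T by simp
        also have "\<dots> = p\<^sup>2 / T ^ 3 + T ^ 3 * q\<^sup>2 - 2 * (p * q)"
          using T by (simp add: field_simps power2_eq_square)
        finally show ?thesis unfolding ee[symmetric] p_def[symmetric] q_def[symmetric] by simp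
      qed
      have "norm (cdot (F x) (w x)) \<le> 3 * norm (F x) * norm (w x)" by (rule norm_cdot_le)
      also have "\<dots> \<le> 3 * norm (F x) * (A * D / T ^ (2 * m) * exp (- (T\<^sup>2 / 2) * x $ 3))"
        using w' by (intro mult_left_mono) auto
      also have "\<dots> = 3 * A * D / T ^ (2 * m) * (norm (F x) * exp (- (T\<^sup>2 / 2) * x $ 3))" by simp
      also have "\<dots> \<le> 3 * A * D / T ^ (2 * m) * (((norm (F x))\<^sup>2 / T ^ 3 + T ^ 3 * exp (- T\<^sup>2 * x $ 3)) / 2)"
        using am A D T by (intro mult_left_mono) auto
      finally show ?thesis by simp
    qed
    have "norm (\<integral>x. cdot (F x) (w x) \<partial>lebesgue_on K) \<le> (\<integral>x. norm (cdot (F x) (w x)) \<partial>lebesgue_on K)"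
      by (rule integral_norm_bound)
    also have "\<dots> \<le> (\<integral>x. ?g x \<partial>lebesgue_on K)"
      using pt by (intro integral_mono integrable_norm int gi) (auto simp: space_restrict_space)
    also have "\<dots> = 3 * A * D / T ^ (2 * m) * (N / T ^ 3 + T ^ 3 * (\<integral>x. exp (- T\<^sup>2 * x $ 3) \<partial>lebesgue_on K)) / 2"
      using Fi e(1) T by (simp add: N_def)
    also have "\<dots> \<le> 3 * A * D / T ^ (2 * m) * (N / T ^ 3 + T ^ 3 * (I / (T\<^sup>2) ^ 3)) / 2"
      using e(2) T A D unfolding I_def by (intro divide_right_mono mult_left_mono add_left_mono) auto
    also have "\<dots> = 3 * D * (N + I) / 2 * A / T ^ (2 * m + 3)"
      using T by (simp add: field_simps power_add flip: power_mult)
    finally show "norm (\<integral>x. cdot (F x) (w x) \<partial>lebesgue_on K) \<le> 3 * D * (N + I) / 2 * A / T ^ (2 * m + 3)" .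
  qed
qed

text \<open>The cone is invariant under dilations, so substituting \<open>x / \<tau>\<close> for \<open>x\<close>, here with \<open>\<tau> = n\<^sup>2\<close>, freezes \<open>h\<close> at its value at the apex;
the convergence is dominated by a multiple of the exponential.\<close>

lemma cone_laplace_asymptotics:
  assumes th: "0 < \<theta>" "\<theta> < pi / 2" and \<rho>: "\<And>x. Re (lin \<rho> x) = - x $ 3"
    and h[measurable]: "h \<in> borel_measurable borel" and B: "\<And>x. norm (h x) \<le> B"
    and h0: "(h \<longlongrightarrow> h0) (at 0 within cone \<theta>)"
  shows "(\<lambda>n. real n ^ 6 *\<^sub>R (\<integral>x. indicator (cone \<theta>) x *\<^sub>R (h x * exp (lin (of_real (real n ^ 2) *s \<rho>) x)) \<partial>lborel))
           \<longlonglongrightarrow> h0 * cone_laplace \<theta> \<rho>"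
proof -
  have [measurable]: "cone \<theta> \<in> sets borel" using open_cone[of \<theta>] th by simp
  let ?g = "\<lambda>n x. indicator (cone \<theta>) x *\<^sub>R (h ((1 / real n ^ 2) *\<^sub>R x) * exp (lin \<rho> x))"
  have scaled: "real n ^ 6 *\<^sub>R (\<integral>x. indicator (cone \<theta>) x *\<^sub>R (h x * exp (lin (of_real (real n ^ 2) *s \<rho>) x)) \<partial>lborel)
      = (\<integral>x. ?g n x \<partial>lborel)" if n: "0 < n" for n
  proof -
    have cs: "(real n ^ 2) *\<^sub>R x \<in> cone \<theta> \<longleftrightarrow> x \<in> cone \<theta>" for x
      using th n by (simp add: cone_iff_norm)
    have "(\<integral>x. ?g n x \<partial>lborel) = (real n ^ 2) ^ 3 *\<^sub>R (\<integral>x. ?g n ((real n ^ 2) *\<^sub>R x) \<partial>lborel)"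
      using n by (subst lborel_integral_scale[where c = "real n ^ 2"]) auto
    also have "(\<lambda>x. ?g n ((real n ^ 2) *\<^sub>R x)) = (\<lambda>x. indicator (cone \<theta>) x *\<^sub>R (h x * exp (lin (of_real (real n ^ 2) *s \<rho>) x)))"
      using n by (auto simp: indicator_def cs lin_scaleR lin_smult)
    finally show ?thesis by (simp flip: power_mult)
  qed
  have "(\<lambda>n. \<integral>x. ?g n x \<partial>lborel) \<longlonglongrightarrow> (\<integral>x. indicator (cone \<theta>) x *\<^sub>R (h0 * exp (lin \<rho> x)) \<partial>lborel)"
  proof (rule integral_dominated_convergence[where w = "\<lambda>x. B * norm (indicator (cone \<theta>) x *\<^sub>R exp (lin \<rho> x))"])
    show "integrable lborel (\<lambda>x. B * norm (indicator (cone \<theta>) x *\<^sub>R exp (lin \<rho> x)))"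
      by (intro integrable_mult_right integrable_norm cone_exp_lin_integrable[OF th \<rho>])
    show "AE x in lborel. (\<lambda>n. ?g n x) \<longlonglongrightarrow> indicator (cone \<theta>) x *\<^sub>R (h0 * exp (lin \<rho> x))"
    proof (rule AE_I2)
      fix x :: "real^3"
      show "(\<lambda>n. ?g n x) \<longlonglongrightarrow> indicator (cone \<theta>) x *\<^sub>R (h0 * exp (lin \<rho> x))"
      proof (cases "x \<in> cone \<theta>")
        case True
        have "filterlim (\<lambda>n. (1 / real n ^ 2) *\<^sub>R x) (at 0 within cone \<theta>) sequentially"
        proof (rule filterlim_at[THEN iffD2], intro conjI)
          have "(\<lambda>n. 1 / real n ^ 2) \<longlonglongrightarrow> 0"
            using tendsto_mult[OF lim_1_over_n lim_1_over_n, where ?'a1 = real] by (simp add: power2_eq_square)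
          then show "(\<lambda>n. (1 / real n ^ 2) *\<^sub>R x) \<longlonglongrightarrow> 0"
            using tendsto_scaleR[of _ 0 sequentially "\<lambda>_. x" x] by simp
          have "x \<noteq> 0" using True th by (auto simp: cone_iff)
          show "\<forall>\<^sub>F n in sequentially. (1 / real n ^ 2) *\<^sub>R x \<in> cone \<theta> \<and> (1 / real n ^ 2) *\<^sub>R x \<noteq> 0"
            by (rule eventually_mono[OF eventually_gt_at_top[of 0]])
              (use True th \<open>x \<noteq> 0\<close> in \<open>auto simp: cone_iff_norm field_simps\<close>)
        qed
        then have "(\<lambda>n. h ((1 / real n ^ 2) *\<^sub>R x)) \<longlonglongrightarrow> h0"
          by (rule filterlim_compose[OF h0])
        then show ?thesis by (intro tendsto_intros)
      qed simp
    qed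
    show "AE x in lborel. norm (?g n x) \<le> B * norm (indicator (cone \<theta>) x *\<^sub>R exp (lin \<rho> x))" for n
      using B by (auto simp: norm_mult indicator_def intro!: AE_I2 mult_right_mono)
  qed measurable
  also have "(\<integral>x. indicator (cone \<theta>) x *\<^sub>R (h0 * exp (lin \<rho> x)) \<partial>lborel) = h0 * cone_laplace \<theta> \<rho>"
  proof -
    have "(\<lambda>x. indicator (cone \<theta>) x *\<^sub>R (h0 * exp (lin \<rho> x))) = (\<lambda>x. h0 * (indicator (cone \<theta>) x *\<^sub>R exp (lin \<rho> x)))"
      by (auto simp: indicator_def)
    then show ?thesis by (simp only: cone_laplace_def integral_mult_right_zero)
  qed
  finally show ?thesis
    by (rule Lim_transform_eventually)
      (rule eventually_mono[OF eventually_gt_at_top[of 0]], rule scaled[symmetric])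
qed

lemma zero_in_closure_truncated_cone:
  assumes "0 < \<theta>" "\<theta> < pi / 2" "0 < r"
  shows "0 \<in> closure (truncated_cone \<theta> r)"
proof (rule closure_sequential[THEN iffD2])
  define e :: "real^3" where "e = axis 3 1"
  have "cos \<theta> < 1" using assms cos_monotone_0_pi[of 0 \<theta>] by simp
  have "(r / (2 + real n)) *\<^sub>R e \<in> truncated_cone \<theta> r" for n
  proof -
    define s where "s = r / (2 + real n)"
    have s: "0 < s" "s < r" using assms by (simp_all add: s_def divide_less_eq add_pos_nonneg algebra_simps)
    then have "cos \<theta> * s < s" using \<open>cos \<theta> < 1\<close> by simp
    then show ?thesis
      unfolding s_def[symmetric] using assms s by (simp add: truncated_cone_def cone_iff_norm e_def)
  qed
  moreover have "(\<lambda>n. r / (2 + real n)) \<longlonglongrightarrow> 0"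
    by (rule real_tendsto_divide_at_top[OF tendsto_const])
      (intro filterlim_tendsto_add_at_top[OF tendsto_const] filterlim_real_sequentially)
  then have "(\<lambda>n. (r / (2 + real n)) *\<^sub>R e) \<longlonglongrightarrow> 0"
    using tendsto_scaleR[of _ 0 sequentially "\<lambda>_. e" e] by simp
  ultimately show "\<exists>x. (\<forall>n. x n \<in> truncated_cone \<theta> r) \<and> x \<longlonglongrightarrow> 0"
    by (intro exI[of _ "\<lambda>n. (r / (2 + real n)) *\<^sub>R e"]) simp
qed

lemma open_truncated_cone: "0 \<le> \<theta> \<Longrightarrow> \<theta> \<le> pi \<Longrightarrow> open (truncated_cone \<theta> r)"
  by (simp add: truncated_cone_def open_cone open_Int)

text \<open>The wave vanishes outside the ball of radius \<open>R\<close>, so the integral over the truncated cone is one over the infinite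
cone, and a source that is continuous up to the apex may be replaced by its value there.\<close>

lemma continuous_source_asymptotics:
  assumes th: "0 < \<theta>" "\<theta> < pi / 2" and \<rho>: "\<And>x. Re (lin \<rho> x) = - x $ 3"
    and R: "0 < R" "R < r" and K: "K = truncated_cone \<theta> r"
    and j: "continuous_on (closure K) j"
  shows "(\<lambda>n. real n ^ 6 *\<^sub>R (\<integral>x. cdot (j x) (wave R (of_real (real n ^ 2) *s \<rho>) v x) \<partial>lebesgue_on K))
           \<longlonglongrightarrow> of_real (cutoff R 0) * cdot (j 0) v * cone_laplace \<theta> \<rho>"
proof -
  have oK: "open K" using th K by (simp add: open_truncated_cone)
  have bK: "bounded K" unfolding K truncated_cone_def by (simp add: bounded_Int)
  have "compact (closure K)" using bK by simp
  then have "bounded (j ` closure K)" by (rule compact_imp_bounded[OF compact_continuous_image[OF j]])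
  then obtain C where C: "\<And>x. x \<in> closure K \<Longrightarrow> norm (j x) \<le> C"
    by (auto simp: bounded_iff)
  have cont: "continuous_on (closure K) (\<lambda>x. of_real (cutoff R x) * cdot (j x) v)"
  proof -
    have "continuous_on UNIV (cutoff R)" using C_k_cutoff[of 0 R] by simp
    then have "continuous_on (closure K) (cutoff R)" by (rule continuous_on_subset) simp
    then show ?thesis unfolding cdot_def by (intro continuous_intros j)
  qed
  define h where "h x = indicator K x *\<^sub>R (of_real (cutoff R x) * cdot (j x) v)" for x
  have hm: "h \<in> borel_measurable borel"
    unfolding h_def
    by (intro borel_measurable_continuous_on_indicator borel_open oK continuous_on_subset[OF cont closure_subset])
  have hB: "norm (h x) \<le> 3 * \<bar>C\<bar> * norm v" for x
  proof (cases "x \<in> K")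
    case True
    then have "x \<in> closure K" using closure_subset by blast
    have "norm (h x) = cutoff R x * norm (cdot (j x) v)"
      using True cutoff_bounds[of R x] by (simp add: h_def norm_mult)
    also have "\<dots> \<le> 1 * (3 * \<bar>C\<bar> * norm v)"
    proof (intro mult_mono cutoff_bounds)
      have "norm (j x) \<le> \<bar>C\<bar>" using C[OF \<open>x \<in> closure K\<close>] by simp
      then have "3 * norm (j x) * norm v \<le> 3 * \<bar>C\<bar> * norm v" by (intro mult_mono) auto
      with norm_cdot_le show "norm (cdot (j x) v) \<le> 3 * \<bar>C\<bar> * norm v" by (rule order_trans)
    qed auto
    finally show ?thesis by simp
  qed (simp add: h_def)
  have 0: "0 \<in> closure K" unfolding K using th R by (intro zero_in_closure_truncated_cone) auto
  have "((\<lambda>x. of_real (cutoff R x) * cdot (j x) v) \<longlongrightarrow> of_real (cutoff R 0) * cdot (j 0) v) (at 0 within closure K)"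
    using cont 0 by (simp add: continuous_on)
  then have "((\<lambda>x. of_real (cutoff R x) * cdot (j x) v) \<longlongrightarrow> of_real (cutoff R 0) * cdot (j 0) v) (at 0 within K)"
    by (rule tendsto_within_subset[OF _ closure_subset])
  then have "(h \<longlongrightarrow> of_real (cutoff R 0) * cdot (j 0) v) (at 0 within K)"
    by (rule Lim_transform_eventually) (auto simp: eventually_at_filter h_def)
  moreover have "at 0 within K = at 0 within cone \<theta>"
    by (rule at_within_nhd[of _ "ball 0 r"]) (use R in \<open>auto simp: K truncated_cone_def\<close>)
  ultimately have "(h \<longlongrightarrow> of_real (cutoff R 0) * cdot (j 0) v) (at 0 within cone \<theta>)" by simp
  note lim = cone_laplace_asymptotics[OF th \<rho> hm hB this]
  have "(\<integral>x. cdot (j x) (wave R \<rho>' v x) \<partial>lebesgue_on K)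
      = (\<integral>x. indicator (cone \<theta>) x *\<^sub>R (h x * exp (lin \<rho>' x)) \<partial>lborel)" for \<rho>'
  proof -
    have "(\<integral>x. cdot (j x) (wave R \<rho>' v x) \<partial>lebesgue_on K)
       = (\<integral>x. indicator K x *\<^sub>R cdot (j x) (wave R \<rho>' v x) \<partial>lebesgue)"
      using oK by (simp add: integral_restrict_space lmeasurable_iff_integrable borel_open)
    also have "\<dots> = (\<integral>x. indicator (cone \<theta>) x *\<^sub>R (h x * exp (lin \<rho>' x)) \<partial>lebesgue)"
      by (intro Bochner_Integration.integral_cong)
        (auto simp: h_def wave_def cdot_smult_right K truncated_cone_def indicator_def)
    also have "\<dots> = (\<integral>x. indicator (cone \<theta>) x *\<^sub>R (h x * exp (lin \<rho>' x)) \<partial>lborel)"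
    proof (rule integral_completion)
      have [measurable]: "cone \<theta> \<in> sets borel" using open_cone[of \<theta>] th by simp
      note hm[measurable]
      show "(\<lambda>x. indicator (cone \<theta>) x *\<^sub>R (h x * exp (lin \<rho>' x))) \<in> borel_measurable lborel"
        by measurable
    qed
    finally show ?thesis .
  qed
  with lim show ?thesis by simp
qed


section \<open>Sources of a Maxwell system vanish at the apex\<close>

lemma continuous_on_closure_L2:
  assumes j: "continuous_on (closure K) j" and K: "open K" "bounded K"
  shows "j \<in> L2 K"
proof -
  have m: "j \<in> borel_measurable (lebesgue_on K)"
    using continuous_on_subset[OF j closure_subset] K
    by (intro continuous_imp_measurable_on_sets_lebesgue) auto
  have "bounded (j ` closure K)"
    using K by (intro compact_imp_bounded compact_continuous_image j) simp
  then obtain C where C: "\<And>x. x \<in> closure K \<Longrightarrow> norm (j x) \<le> C"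
    by (auto simp: bounded_iff)
  interpret finite_measure "lebesgue_on K"
    using K by (intro finite_measure_lebesgue_on lmeasurable_open)
  have "integrable (lebesgue_on K) (\<lambda>x. (norm (j x))\<^sup>2)"
  proof (rule integrable_const_bound[of _ "C\<^sup>2"])
    have "norm ((norm (j x))\<^sup>2) \<le> C\<^sup>2" if "x \<in> K" for x
      using C[of x] that closure_subset[of K] by (simp add: power_mono subset_iff)
    then show "AE x in lebesgue_on K. norm ((norm (j x))\<^sup>2) \<le> C\<^sup>2"
      by (intro AE_I2) (auto simp: space_restrict_space)
  qed (use m in measurable)
  with m show ?thesis by (simp add: L2_def)
qed

lemma linear_ccross_left: "bounded_linear (\<lambda>a. ccross a v)"
proof (rule bounded_linear_intro[where K = "6 * norm v"])
  show "norm (ccross a v) \<le> norm a * (6 * norm v)" for a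
    using norm_ccross_le[of a v] by (simp add: mult_ac)
qed (simp_all add: ccross_def vec_eq_iff forall_3 algebra_simps scaleR_conv_of_real[where 'a=complex])

lemma ccross_smult_left: "ccross (z *s a) v = z *s ccross a v"
  by (simp add: ccross_def vec_eq_iff forall_3 algebra_simps)

lemma ccross_self: "ccross a a = 0"
  by (simp add: ccross_def vec_eq_iff forall_3 algebra_simps)

lemma continuous_on_wave: "continuous_on S (wave R \<rho> v)"
  using C_k_wave[of 0 R \<rho> v] continuous_on_subset by auto

lemma continuous_on_cutoff_grad: "continuous_on S (cutoff_grad R)"
proof -
  have "isCont (flat 2) s" for s using flat_has_derivative DERIV_isCont by blast
  then have "continuous_on UNIV (flat 2)" by (simp add: continuous_on_eq_continuous_at)
  then have "continuous_on S (\<lambda>x. flat 2 (R ^ 4 - (x \<bullet> x)\<^sup>2))"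
    by (rule continuous_on_compose2) (auto intro!: continuous_intros)
  then show ?thesis unfolding cutoff_grad_def
    by (intro continuous_on_vec_lambda continuous_on_of_real continuous_on_mult)
      (auto intro!: continuous_intros)
qed

lemma continuous_on_smult_vec:
  "continuous_on S f \<Longrightarrow> continuous_on S g \<Longrightarrow> continuous_on S (\<lambda>x. f x *s (g x :: complex^3))"
  by (rule bounded_bilinear.continuous_on[OF bounded_bilinear_smult_vec])

lemma continuous_on_curl_wave: "continuous_on S (curl (wave R \<rho> v))"
  unfolding curl_wave[abs_def]
  by (intro continuous_on_add continuous_on_wave continuous_on_smult_vec continuous_on_exp
      continuous_on_lin bounded_linear.continuous_on[OF linear_ccross_left] continuous_on_cutoff_grad)

text \<open>Vanishing of order \<open>1 / n\<^sup>k\<close>. Index zero is left out because of the convention for division by zero.\<close>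

definition decays :: "nat \<Rightarrow> (nat \<Rightarrow> complex) \<Rightarrow> bool" where
  "decays k f \<longleftrightarrow> (\<exists>C\<ge>0. \<forall>n>0. norm (f n) \<le> C / real n ^ k)"

lemma decaysI: "(\<And>n. 0 < n \<Longrightarrow> norm (f n) \<le> C / real n ^ k) \<Longrightarrow> decays k f"
  unfolding decays_def
proof (intro exI[of _ "\<bar>C\<bar>"] conjI allI impI)
  fix n :: nat assume "\<And>n. 0 < n \<Longrightarrow> norm (f n) \<le> C / real n ^ k" "0 < n"
  then have "norm (f n) \<le> C / real n ^ k" by blast
  also have "\<dots> \<le> \<bar>C\<bar> / real n ^ k" by (intro divide_right_mono) auto
  finally show "norm (f n) \<le> \<bar>C\<bar> / real n ^ k" .
qed simp

lemma decays_mono: "decays k f \<Longrightarrow> l \<le> k \<Longrightarrow> decays l f"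
proof -
  assume "decays k f" and l: "l \<le> k"
  then obtain C where C: "0 \<le> C" "\<And>n. 0 < n \<Longrightarrow> norm (f n) \<le> C / real n ^ k"
    unfolding decays_def by auto
  have "C / real n ^ k \<le> C / real n ^ l" if "0 < n" for n
    using that C(1) l by (intro divide_left_mono power_increasing) auto
  then show ?thesis using C(2) by (intro decaysI[of _ C]) (meson order_trans)
qed

lemma decays_add: "decays k f \<Longrightarrow> decays k g \<Longrightarrow> decays k (\<lambda>n. f n + g n)"
proof -
  assume "decays k f" "decays k g"
  then obtain C D where C: "\<And>n. 0 < n \<Longrightarrow> norm (f n) \<le> C / real n ^ k"
    and D: "\<And>n. 0 < n \<Longrightarrow> norm (g n) \<le> D / real n ^ k"
    unfolding decays_def by auto
  show ?thesis
  proof (rule decaysI[of _ "C + D"])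
    show "norm (f n + g n) \<le> (C + D) / real n ^ k" if "0 < n" for n
      using norm_triangle_ineq[of "f n" "g n"] C[OF that] D[OF that] by (simp add: add_divide_distrib)
  qed
qed

lemma decays_cmult: "decays k f \<Longrightarrow> decays k (\<lambda>n. c * f n)"
proof -
  assume "decays k f"
  then obtain C where C: "\<And>n. 0 < n \<Longrightarrow> norm (f n) \<le> C / real n ^ k"
    unfolding decays_def by auto
  show ?thesis
  proof (rule decaysI[of _ "norm c * C"])
    show "norm (c * f n) \<le> norm c * C / real n ^ k" if "0 < n" for n
      using mult_left_mono[OF C[OF that], of "norm c"] by (simp add: norm_mult)
  qed
qed

lemma decays_diff: "decays k f \<Longrightarrow> decays k g \<Longrightarrow> decays k (\<lambda>n. f n - g n)"
  using decays_add[of k f "\<lambda>n. - 1 * g n"] decays_cmult[of k g "- 1"] by simp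

lemma decays_divide:
  "decays k (\<lambda>n. of_real (real n ^ l) * f n) \<Longrightarrow> decays (k + l) f"
proof -
  assume "decays k (\<lambda>n. of_real (real n ^ l) * f n)"
  then obtain C where C: "\<And>n. 0 < n \<Longrightarrow> norm (of_real (real n ^ l) * f n) \<le> C / real n ^ k"
    unfolding decays_def by auto
  show ?thesis
  proof (rule decaysI[of _ C])
    show "norm (f n) \<le> C / real n ^ (k + l)" if "0 < n" for n
      using C[OF that] that by (simp add: norm_mult norm_power field_simps power_add)
  qed
qed

lemma decays_of_convergent:
  assumes "(\<lambda>n. real n ^ k *\<^sub>R f n) \<longlonglongrightarrow> l" shows "decays k f"
proof -
  have "Bseq (\<lambda>n. real n ^ k *\<^sub>R f n)" using assms convergentI convergent_imp_Bseq by blast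
  then obtain C where C: "\<And>n. norm (real n ^ k *\<^sub>R f n) \<le> C" by (auto simp: Bseq_def)
  show ?thesis
  proof (rule decaysI[of _ C])
    show "norm (f n) \<le> C / real n ^ k" if "0 < n" for n
      using C[of n] that by (simp add: field_simps)
  qed
qed

lemma decays_limit_0:
  assumes "(\<lambda>n. real n ^ k *\<^sub>R f n) \<longlonglongrightarrow> l" "decays (Suc k) f" shows "l = 0"
proof -
  obtain C where C: "\<And>n. 0 < n \<Longrightarrow> norm (f n) \<le> C / real n ^ Suc k"
    using assms(2) unfolding decays_def by auto
  have "(\<lambda>n. real n ^ k *\<^sub>R f n) \<longlonglongrightarrow> 0"
  proof (rule Lim_null_comparison)
    show "(\<lambda>n. C * (1 / real n)) \<longlonglongrightarrow> 0"
      using tendsto_mult_right_zero[OF lim_1_over_n] by blast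
    have "norm (real n ^ k *\<^sub>R f n) \<le> C * (1 / real n)" if "0 < n" for n
      using C[OF that] that by (simp add: field_simps)
    then show "\<forall>\<^sub>F n in sequentially. norm (real n ^ k *\<^sub>R f n) \<le> C * (1 / real n)"
      by (rule eventually_mono[OF eventually_gt_at_top[of 0]])
  qed
  then show ?thesis using assms(1) LIMSEQ_unique by blast
qed

text \<open>The three tests, with polarisations \<open>n2\<close>, \<open>n1\<close> and \<open>\<rho>\<close>. Each use of \<open>\<rho> \<times> v\<close> under a curl carries a factor
\<open>\<tau> = n\<^sup>2\<close>, which is gained when solving for the pairing: the pairings of \<open>E\<close> with \<open>n1\<close> and of \<open>H\<close> with \<open>\<rho>\<close> improve from
\<open>n^(-3)\<close> to \<open>n^(-5)\<close> and \<open>n^(-7)\<close>. In the last test the large factor disappears since \<open>\<rho> \<times> \<rho> = 0\<close>, and the pairing of \<open>j\<close>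
with \<open>\<rho>\<close> decays faster than the order \<open>n^(-6)\<close> that a nonzero value at the apex would produce.\<close>

lemma corner_source_orthogonal_to_null_vector:
  assumes th: "0 < \<theta>" "\<theta> < pi / 2" and R: "0 < R" "R < r" and K: "K = truncated_cone \<theta> r"
    and \<rho>: "\<And>x. Re (lin \<rho> x) = - x $ 3"
    and n12: "ccross \<rho> n2 = n1" "ccross \<rho> n1 = \<rho>" and lap: "cone_laplace \<theta> \<rho> \<noteq> 0"
    and E: "E \<in> L2 K" and H: "H \<in> L2 K"
    and j: "continuous_on (closure K) j" and m: "continuous_on (closure K) m" and b: "b \<noteq> 0"
    and curlE: "\<And>\<rho> v. (\<integral>x. cdot (a *s H x + b *s j x) (wave R \<rho> v x) \<partial>lebesgue_on K)
        = (\<integral>x. cdot (E x) (curl (wave R \<rho> v) x) \<partial>lebesgue_on K)"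
    and curlH: "\<And>\<rho> v. (\<integral>x. cdot (c *s E x + d *s m x) (wave R \<rho> v x) \<partial>lebesgue_on K)
        = (\<integral>x. cdot (H x) (curl (wave R \<rho> v) x) \<partial>lebesgue_on K)"
  shows "cdot (j 0) \<rho> = 0"
proof -
  have oK: "open K" using th K by (simp add: open_truncated_cone)
  have bK: "bounded K" unfolding K truncated_cone_def by (simp add: bounded_Int)
  have Kc: "K \<subseteq> cone \<theta>" and Kr: "K \<subseteq> ball 0 r" by (auto simp: K truncated_cone_def)
  have Ks: "K \<in> sets lebesgue" using oK by simp
  have Kl: "K \<in> lmeasurable" using oK bK by (rule lmeasurable_open[rotated])
  have jL: "j \<in> L2 K" and mL: "m \<in> L2 K"
    using continuous_on_closure_L2[OF _ oK bK] j m by auto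
  define \<rho>n where "\<rho>n n = of_real (real n ^ 2) *s \<rho>" for n
  define tail where "tail n v x = exp (lin (\<rho>n n) x) *s ccross (cutoff_grad R x) v" for n v x
  define X where "X F v n = (\<integral>x. cdot (F x) (wave R (\<rho>n n) v x) \<partial>lebesgue_on K)" for F v n
  define Y where "Y F v n = (\<integral>x. cdot (F x) (tail n v x) \<partial>lebesgue_on K)" for F v n
  have e: "Re (lin (\<rho>n n) x) = - (real n ^ 2) * x $ 3" for n x
    unfolding \<rho>n_def lin_smult
    by (simp add: \<rho> del: of_real_power of_real_of_nat_eq)
  have e1: "exp (- (real n ^ 2) * x $ 3) \<le> 1" if "x \<in> K" for n x
    using that Kc th by (auto simp: cone_iff)
  have wave_le: "norm (wave R (\<rho>n n) v x) \<le> norm v * norm x ^ 0 * exp (- (real n ^ 2) * x $ 3)" for n v x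
  proof -
    have "norm (wave R (\<rho>n n) v x) = cutoff R x * (norm v * exp (- (real n ^ 2) * x $ 3))"
      using cutoff_bounds[of R x] by (simp add: wave_def norm_smult_vec norm_mult e)
    also have "\<dots> \<le> 1 * (norm v * exp (- (real n ^ 2) * x $ 3))"
      using cutoff_bounds[of R x] by (intro mult_right_mono) auto
    finally show ?thesis by simp
  qed
  have tail_le: "norm (tail n v x) \<le> 288 * norm v * norm x ^ 3 * exp (- (real n ^ 2) * x $ 3)" for n v x
  proof -
    have "norm (tail n v x) = exp (- (real n ^ 2) * x $ 3) * norm (ccross (cutoff_grad R x) v)"
      by (simp add: tail_def norm_smult_vec e)
    also have "norm (ccross (cutoff_grad R x) v) \<le> 6 * norm (cutoff_grad R x) * norm v"
      by (rule norm_ccross_le)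
    also have "\<dots> \<le> 6 * (48 * norm x ^ 3) * norm v"
      by (intro mult_right_mono mult_left_mono norm_cutoff_grad) auto
    finally show ?thesis by (simp add: mult_ac)
  qed
  have intX: "integrable (lebesgue_on K) (\<lambda>x. cdot (F x) (wave R (\<rho>n n) v x))" if "F \<in> L2 K" for F n v
  proof (rule integrable_cdot_bounded[OF that Kl])
    show "wave R (\<rho>n n) v \<in> borel_measurable (lebesgue_on K)"
      by (intro continuous_imp_measurable_on_sets_lebesgue continuous_on_wave Ks)
    show "norm (wave R (\<rho>n n) v x) \<le> norm v" if "x \<in> K" for x
      using wave_le[of n v x] mult_left_mono[OF e1[OF that, of n], of "norm v"] by simp
  qed
  have intY: "integrable (lebesgue_on K) (\<lambda>x. cdot (F x) (tail n v x))" if "F \<in> L2 K" for F n v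
  proof (rule integrable_cdot_bounded[OF that Kl])
    show "tail n v \<in> borel_measurable (lebesgue_on K)"
      unfolding tail_def
      by (intro continuous_imp_measurable_on_sets_lebesgue Ks continuous_on_smult_vec continuous_on_exp
          continuous_on_lin bounded_linear.continuous_on[OF linear_ccross_left] continuous_on_cutoff_grad)
    show "norm (tail n v x) \<le> 288 * norm v * r ^ 3" if "x \<in> K" for x
    proof -
      have "norm x ^ 3 \<le> r ^ 3" using that Kr by (intro power_mono) auto
      then have "288 * norm v * norm x ^ 3 * exp (- (real n ^ 2) * x $ 3) \<le> 288 * norm v * r ^ 3 * 1"
        using e1[OF that, of n] R by (intro mult_mono) auto
      then show ?thesis using tail_le[of n v x] by linarith
    qed
  qed
  have decX: "decays 3 (X F v)" if F: "F \<in> L2 K" for F v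
  proof -
    obtain C where "\<And>T A w. 0 < T \<Longrightarrow> 0 \<le> A \<Longrightarrow> (\<And>x. x \<in> K \<Longrightarrow> norm (w x) \<le> A * norm x ^ 0 * exp (- (T\<^sup>2) * x $ 3))
      \<Longrightarrow> integrable (lebesgue_on K) (\<lambda>x. cdot (F x) (w x))
      \<Longrightarrow> norm (\<integral>x. cdot (F x) (w x) \<partial>lebesgue_on K) \<le> C * A / T ^ (2 * 0 + 3)"
      using L2_pairing_decay[OF th F Kc Ks, of 0] by blast
    from this[OF _ _ wave_le intX[OF F]] show ?thesis
      by (intro decaysI[of _ "C * norm v"]) (simp add: X_def)
  qed
  have decY: "decays 9 (Y F v)" if F: "F \<in> L2 K" for F v
  proof -
    obtain C where "\<And>T A w. 0 < T \<Longrightarrow> 0 \<le> A \<Longrightarrow> (\<And>x. x \<in> K \<Longrightarrow> norm (w x) \<le> A * norm x ^ 3 * exp (- (T\<^sup>2) * x $ 3))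
      \<Longrightarrow> integrable (lebesgue_on K) (\<lambda>x. cdot (F x) (w x))
      \<Longrightarrow> norm (\<integral>x. cdot (F x) (w x) \<partial>lebesgue_on K) \<le> C * A / T ^ (2 * 3 + 3)"
      using L2_pairing_decay[OF th F Kc Ks, of 3] by blast
    from this[OF _ _ tail_le intY[OF F]] show ?thesis
      by (intro decaysI[of _ "C * (288 * norm v)"]) (simp add: Y_def)
  qed
  note source = continuous_source_asymptotics[OF th \<rho> R K, folded \<rho>n_def]
  have decS: "decays 6 (X g v)" if "continuous_on (closure K) g" for g v
    using decays_of_convergent[OF source[OF that]] unfolding X_def .
  have split: "(\<integral>x. cdot (F x) (curl (wave R (\<rho>n n) v) x) \<partial>lebesgue_on K)
      = of_real (real n ^ 2) * X F (ccross \<rho> v) n + Y F v n" if F: "F \<in> L2 K" for F v n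
  proof -
    have "cdot (F x) (curl (wave R (\<rho>n n) v) x)
       = of_real (real n ^ 2) * cdot (F x) (wave R (\<rho>n n) (ccross \<rho> v) x) + cdot (F x) (tail n v x)" for x
      unfolding curl_wave cdot_add_right tail_def \<rho>n_def ccross_smult_left
      by (simp add: wave_def cdot_smult_right mult_ac)
    then show ?thesis
      unfolding X_def Y_def using intX[OF F] intY[OF F] by simp
  qed
  have lin2: "(\<integral>x. cdot (p *s F x + q *s G x) (wave R (\<rho>n n) v x) \<partial>lebesgue_on K) = p * X F v n + q * X G v n"
    if "F \<in> L2 K" "G \<in> L2 K" for F G p q v n
    unfolding X_def cdot_add_left cdot_smult_left using intX[OF that(1)] intX[OF that(2)] by simp
  have eqE: "a * X H v n + b * X j v n = of_real (real n ^ 2) * X E (ccross \<rho> v) n + Y E v n" for v n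
    using curlE[of "\<rho>n n" v] unfolding lin2[OF H jL] split[OF E] .
  have eqH: "c * X E v n + d * X m v n = of_real (real n ^ 2) * X H (ccross \<rho> v) n + Y H v n" for v n
    using curlH[of "\<rho>n n" v] unfolding lin2[OF E mL] split[OF H] .
  \<comment> \<open>First test: polarisation \<open>n2\<close>, limited by the \<open>L\<^sup>2\<close> bound for \<open>H\<close>.\<close>
  have "decays 3 (\<lambda>n. (a * X H n2 n + b * X j n2 n) - Y E n2 n)"
    by (intro decays_diff decays_add decays_cmult decX H decays_mono[OF decS[OF j]] decays_mono[OF decY[OF E]]) auto
  then have "decays 3 (\<lambda>n. of_real (real n ^ 2) * X E n1 n)"
    unfolding eqE n12 by simp
  then have XE: "decays 5 (X E n1)" using decays_divide[of 3 2] by simp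
  \<comment> \<open>Second test: polarisation \<open>n1\<close>. The continuous source contributes order 6, not merely 3.\<close>
  have "decays 5 (\<lambda>n. (c * X E n1 n + d * X m n1 n) - Y H n1 n)"
    by (intro decays_diff decays_add decays_cmult XE decays_mono[OF decS[OF m]] decays_mono[OF decY[OF H]]) auto
  then have "decays 5 (\<lambda>n. of_real (real n ^ 2) * X H \<rho> n)"
    unfolding eqH n12 by simp
  then have XH: "decays 7 (X H \<rho>)" using decays_divide[of 5 2] by simp
  \<comment> \<open>Third test: polarisation \<open>\<rho>\<close>, whose cross product with \<open>\<rho>\<close> vanishes.\<close>
  have X0: "X E 0 n = 0" for n by (simp add: X_def wave_def cdot_def)
  have "decays 7 (\<lambda>n. Y E \<rho> n - a * X H \<rho> n)"
    by (intro decays_diff decays_cmult XH decays_mono[OF decY[OF E]]) auto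
  moreover have "Y E \<rho> n - a * X H \<rho> n = b * X j \<rho> n" for n
    using eqE[of \<rho> n] X0[of n] by (simp add: ccross_self algebra_simps)
  ultimately have "decays 7 (\<lambda>n. b * X j \<rho> n)" by simp
  from decays_cmult[OF this, of "inverse b"] have "decays (Suc 6) (X j \<rho>)"
    using b by (simp add: mult.assoc[symmetric])
  then have "of_real (cutoff R 0) * cdot (j 0) \<rho> * cone_laplace \<theta> \<rho> = 0"
    by (rule decays_limit_0[OF source[OF j, of \<rho>, folded X_def]])
  then show ?thesis using lap cutoff_0[OF R(1)] by simp
qed

text \<open>The null vectors \<open>(\<plusminus>\<i>, 0, -1)\<close> and \<open>(0, \<i>, -1)\<close> span, so orthogonality to them for the bilinear product is enough.\<close>

lemma corner_source_vanishes:
  assumes th: "0 < \<theta>" "\<theta> < pi / 2" and R: "0 < R" "R < r" and K: "K = truncated_cone \<theta> r"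
    and E: "E \<in> L2 K" and H: "H \<in> L2 K"
    and j: "continuous_on (closure K) j" and m: "continuous_on (closure K) m" and b: "b \<noteq> 0"
    and curlE: "\<And>\<rho> v. (\<integral>x. cdot (a *s H x + b *s j x) (wave R \<rho> v x) \<partial>lebesgue_on K)
        = (\<integral>x. cdot (E x) (curl (wave R \<rho> v) x) \<partial>lebesgue_on K)"
    and curlH: "\<And>\<rho> v. (\<integral>x. cdot (c *s E x + d *s m x) (wave R \<rho> v x) \<partial>lebesgue_on K)
        = (\<integral>x. cdot (H x) (curl (wave R \<rho> v) x) \<partial>lebesgue_on K)"
  shows "j 0 = 0"
proof -
  have orth: "cdot (j 0) \<rho> = 0"
    if i: "i = 1 \<or> i = 2" and s: "s = 1 \<or> s = - 1" and \<rho>: "\<And>x. lin \<rho> x = Complex (- x $ 3) (s * x $ i)"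
      and sq: "\<rho> $ 3 = - 1" "\<rho> $ 1 * \<rho> $ 1 + \<rho> $ 2 * \<rho> $ 2 = - 1" for \<rho> i s
  proof (rule corner_source_orthogonal_to_null_vector[OF th R K _ _ _ _ E H j m b curlE curlH])
    show "Re (lin \<rho> x) = - x $ 3" for x by (simp add: \<rho>)
    \<comment> \<open>The chain of polarisations starts at \<open>- e\<^sub>3\<close>.\<close>
    show "ccross \<rho> (vector [0, 0, - 1]) = vector [- \<rho> $ 2, \<rho> $ 1, 0]"
      by (simp add: ccross_def)
    show "ccross \<rho> (vector [- \<rho> $ 2, \<rho> $ 1, 0]) = \<rho>"
      using sq by (simp add: ccross_def vec_eq_iff forall_3)
    have "0 < Re (cone_laplace \<theta> \<rho>)"
      unfolding Re_cone_laplace[OF th i s \<rho>] using tan_gt_zero[OF th]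
      by (intro divide_pos_pos mult_pos_pos zero_less_power) (auto simp: add_pos_nonneg)
    then show "cone_laplace \<theta> \<rho> \<noteq> 0" by auto
  qed
  have "cdot (j 0) (vector [\<i>, 0, - 1]) = 0" "cdot (j 0) (vector [- \<i>, 0, - 1]) = 0" "cdot (j 0) (vector [0, \<i>, - 1]) = 0"
    by (rule orth[of 1 1] orth[of 1 "- 1"] orth[of 2 1]; simp add: lin_3 complex_eq_iff)+
  then have 1: "\<i> * j 0 $ 1 = j 0 $ 3" "- (\<i> * j 0 $ 1) = j 0 $ 3" "\<i> * j 0 $ 2 = j 0 $ 3"
    by (simp_all add: cdot_3 algebra_simps)
  then have "j 0 $ 3 = - j 0 $ 3" by simp
  then have "j 0 $ 3 = 0" by simp
  with 1 show ?thesis by (simp add: vec_eq_iff forall_3)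
qed


section \<open>Tangential traces and continuous representatives\<close>

lemma L2_subset:
  assumes F: "F \<in> L2 \<Omega>" and K: "K \<subseteq> \<Omega>" "K \<in> sets lebesgue" "\<Omega> \<in> sets lebesgue"
  shows "F \<in> L2 K"
proof -
  have "F \<in> borel_measurable (lebesgue_on K)"
    using F K by (auto simp: L2_def intro: measurable_restrict_mono)
  moreover have "integrable (lebesgue_on K) (\<lambda>x. (norm (F x))\<^sup>2)"
  proof -
    have "set_integrable lebesgue \<Omega> (\<lambda>x. (norm (F x))\<^sup>2)"
      using F K by (simp add: L2_def integrable_restrict_space set_integrable_def)
    then have "set_integrable lebesgue K (\<lambda>x. (norm (F x))\<^sup>2)"
      using K by (rule_tac set_integrable_subset)
    then show ?thesis using K by (simp add: integrable_restrict_space set_integrable_def)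
  qed
  ultimately show ?thesis by (simp add: L2_def)
qed

lemma L2_diff: "F \<in> L2 K \<Longrightarrow> G \<in> L2 K \<Longrightarrow> (\<lambda>x. F x - G x) \<in> L2 K"
proof -
  assume F: "F \<in> L2 K" and G: "G \<in> L2 K"
  have [measurable]: "F \<in> borel_measurable (lebesgue_on K)" "G \<in> borel_measurable (lebesgue_on K)"
    using F G by (simp_all add: L2_def)
  have "integrable (lebesgue_on K) (\<lambda>x. (norm (F x - G x))\<^sup>2)"
  proof (rule Bochner_Integration.integrable_bound)
    show "integrable (lebesgue_on K) (\<lambda>x. 2 * (norm (F x))\<^sup>2 + 2 * (norm (G x))\<^sup>2)"
      using F G by (simp add: L2_def)
    have "(norm (F x - G x))\<^sup>2 \<le> 2 * (norm (F x))\<^sup>2 + 2 * (norm (G x))\<^sup>2" for x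
    proof -
      have "(norm (F x - G x))\<^sup>2 \<le> (norm (F x) + norm (G x))\<^sup>2"
        by (intro power_mono norm_triangle_ineq4) simp
      also have "\<dots> \<le> 2 * (norm (F x))\<^sup>2 + 2 * (norm (G x))\<^sup>2"
        using zero_le_power2[of "norm (F x) - norm (G x)"] by (simp add: power2_diff power2_sum)
      finally show ?thesis .
    qed
    then show "AE x in lebesgue_on K. norm ((norm (F x - G x))\<^sup>2) \<le> norm (2 * (norm (F x))\<^sup>2 + 2 * (norm (G x))\<^sup>2)"
      by (intro AE_I2) simp
  qed measurable
  then show ?thesis by (simp add: L2_def)
qed

lemma weak_curl_L2: "F \<in> Hcurl \<Omega> \<Longrightarrow> weak_curl \<Omega> F \<in> L2 \<Omega>"
  unfolding Hcurl_def weak_curl_def by (smt (verit, best) mem_Collect_eq someI_ex)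

lemma continuous_bounded_on_bounded:
  fixes f :: "'a::euclidean_space \<Rightarrow> 'b::real_normed_vector"
  assumes "continuous_on UNIV f" "bounded S"
  obtains B where "\<And>x. x \<in> S \<Longrightarrow> norm (f x) \<le> B"
proof -
  have "bounded (f ` closure S)"
    using assms continuous_on_subset by (intro compact_imp_bounded compact_continuous_image) auto
  then obtain B where "\<And>x. x \<in> closure S \<Longrightarrow> norm (f x) \<le> B" by (auto simp: bounded_iff)
  then show thesis using that closure_subset by blast
qed

text \<open>Equality of the tangential traces is equality of two Green functionals, and on a test field supported near the
apex it is the weak form of \<open>curl (F - F0) = G\<close> without any boundary term.\<close>

lemma curl_identity_near_trace:
  assumes \<Omega>: "open \<Omega>" "bounded \<Omega>" and K: "open K" "K = \<Omega> \<inter> ball 0 r" and R: "0 < R" "R < r"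
    and \<Gamma>: "cball 0 R \<subseteq> - (frontier \<Omega> - \<Gamma>)"
    and F: "F \<in> Hcurl \<Omega>" "F0 \<in> Hcurl \<Omega>" and tr: "tangential_trace_eq_on \<Omega> \<Gamma> F F0"
    and G: "AE x in lebesgue_on K. weak_curl \<Omega> F x - weak_curl \<Omega> F0 x = G x"
    and Gm: "G \<in> borel_measurable (lebesgue_on K)"
  shows "(\<integral>x. cdot (G x) (wave R \<rho> v x) \<partial>lebesgue_on K)
       = (\<integral>x. cdot (F x - F0 x) (curl (wave R \<rho> v) x) \<partial>lebesgue_on K)"
proof -
  define \<phi> where "\<phi> = wave R \<rho> v"
  have out: "\<phi> x = 0" "curl \<phi> x = 0" if "R \<le> norm x" for x
  proof -
    have "cutoff R x = 0" using that R cutoff_outside by simp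
    moreover have "cutoff_grad R x = 0"
    proof -
      have "R ^ 4 \<le> norm x ^ 4" using that R by (intro power_mono) auto
      then have "R ^ 4 - (x \<bullet> x)\<^sup>2 \<le> 0" by (simp add: power2_norm_eq_inner[symmetric])
      then show ?thesis by (simp add: cutoff_grad_def flat_def vec_eq_iff)
    qed
    ultimately show "\<phi> x = 0" "curl \<phi> x = 0"
      by (simp_all add: \<phi>_def wave_def curl_wave ccross_def vec_eq_iff forall_3)
  qed
  have sets: "K \<in> sets lebesgue" "\<Omega> \<in> sets lebesgue" "K \<subseteq> \<Omega>" using \<Omega> K by auto
  have \<Omega>l: "\<Omega> \<in> lmeasurable" using \<Omega> by (intro lmeasurable_open)
  have c: "continuous_on UNIV \<phi>" "continuous_on UNIV (curl \<phi>)"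
    unfolding \<phi>_def by (rule continuous_on_wave continuous_on_curl_wave)+
  have \<phi>m: "\<phi> \<in> borel_measurable (lebesgue_on S)" "curl \<phi> \<in> borel_measurable (lebesgue_on S)" if "S \<in> sets lebesgue" for S
    using continuous_imp_measurable_on_sets_lebesgue[OF continuous_on_subset[OF c(1)] that]
      continuous_imp_measurable_on_sets_lebesgue[OF continuous_on_subset[OF c(2)] that] by auto
  have int: "integrable (lebesgue_on \<Omega>) (\<lambda>x. cdot (A x) (w x))"
    if "A \<in> L2 \<Omega>" "w = \<phi> \<or> w = curl \<phi>" for A w
  proof -
    have "continuous_on UNIV w" using that c by auto
    then obtain B where "\<And>x. x \<in> \<Omega> \<Longrightarrow> norm (w x) \<le> B"
      using continuous_bounded_on_bounded[OF _ \<Omega>(2)] by blast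
    then show ?thesis using that \<phi>m sets \<Omega>l by (intro integrable_cdot_bounded) auto
  qed
  have L: "F \<in> L2 \<Omega>" "F0 \<in> L2 \<Omega>" "weak_curl \<Omega> F \<in> L2 \<Omega>" "weak_curl \<Omega> F0 \<in> L2 \<Omega>"
    using F weak_curl_L2 by (auto simp: Hcurl_def)
  have toK: "(\<integral>x. cdot (A x) (w x) \<partial>lebesgue_on \<Omega>) = (\<integral>x. cdot (A x) (w x) \<partial>lebesgue_on K)"
    if "w = \<phi> \<or> w = curl \<phi>" for A w
  proof -
    have eq: "indicator \<Omega> x *\<^sub>R cdot (A x) (w x) = indicator K x *\<^sub>R cdot (A x) (w x)" for x
      using out[of x] that R K by (cases "R \<le> norm x") (auto simp: cdot_def indicator_def)
    have "(\<integral>x. cdot (A x) (w x) \<partial>lebesgue_on S) = (\<integral>x. indicator S x *\<^sub>R cdot (A x) (w x) \<partial>lebesgue)"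
      if "S \<in> sets lebesgue" for S
      using that by (intro integral_restrict_space) simp
    from this[OF sets(1)] this[OF sets(2)] show ?thesis unfolding eq by simp
  qed
  have diff: "cdot (A - A') w = cdot A w - cdot A' w" for A A' w
    by (simp add: cdot_3 algebra_simps)
  have "\<phi> \<in> test_fields (- (frontier \<Omega> - \<Gamma>))"
    unfolding \<phi>_def using R \<Gamma> by (intro wave_test_field) auto
  then have "tangential_trace \<Omega> F \<phi> = tangential_trace \<Omega> F0 \<phi>"
    using tr by (simp add: tangential_trace_eq_on_def)
  then have "(\<integral>x. cdot (weak_curl \<Omega> F x - weak_curl \<Omega> F0 x) (\<phi> x) \<partial>lebesgue_on \<Omega>)
      = (\<integral>x. cdot (F x - F0 x) (curl \<phi> x) \<partial>lebesgue_on \<Omega>)"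
    using int L by (simp add: tangential_trace_def diff algebra_simps)
  then have "(\<integral>x. cdot (weak_curl \<Omega> F x - weak_curl \<Omega> F0 x) (\<phi> x) \<partial>lebesgue_on K)
      = (\<integral>x. cdot (F x - F0 x) (curl \<phi> x) \<partial>lebesgue_on K)"
    by (simp add: toK)
  also have "(\<integral>x. cdot (weak_curl \<Omega> F x - weak_curl \<Omega> F0 x) (\<phi> x) \<partial>lebesgue_on K)
      = (\<integral>x. cdot (G x) (\<phi> x) \<partial>lebesgue_on K)"
  proof (rule integral_cong_AE)
    have "(\<lambda>x. weak_curl \<Omega> F x - weak_curl \<Omega> F0 x) \<in> L2 K"
      using L sets by (intro L2_diff L2_subset[of _ \<Omega> K])
    then show "(\<lambda>x. cdot (weak_curl \<Omega> F x - weak_curl \<Omega> F0 x) (\<phi> x)) \<in> borel_measurable (lebesgue_on K)"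
      using \<phi>m sets by (intro measurable_cdot) (auto simp: L2_def)
    show "(\<lambda>x. cdot (G x) (\<phi> x)) \<in> borel_measurable (lebesgue_on K)"
      using \<phi>m sets Gm by (intro measurable_cdot) auto
    show "AE x in lebesgue_on K. cdot (weak_curl \<Omega> F x - weak_curl \<Omega> F0 x) (\<phi> x) = cdot (G x) (\<phi> x)"
      using G by eventually_elim simp
  qed
  finally show ?thesis unfolding \<phi>_def .
qed

text \<open>This is the uniqueness of continuous representatives: an open null set is empty, and the closure adds only
limits.\<close>

lemma AE_zero_on_closure:
  fixes f :: "real^3 \<Rightarrow> 'b::real_normed_vector"
  assumes K: "open K" and f: "continuous_on (closure K) f" and AE: "AE x in lebesgue_on K. f x = 0"
    and x: "x \<in> closure K"
  shows "f x = 0"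
proof -
  define N where "N = {x \<in> K. f x \<noteq> 0}"
  have "N = K \<inter> f -` (- {0})" by (auto simp: N_def)
  then have "open N"
    using continuous_open_preimage[OF continuous_on_subset[OF f closure_subset] K, of "- {0}"] by (simp add: open_Compl)
  moreover have "negligible N"
  proof -
    have "AE x in lebesgue. x \<notin> N"
      using AE K by (simp add: AE_restrict_space_iff N_def)
    then have "{x \<in> space lebesgue. \<not> x \<notin> N} \<in> null_sets lebesgue"
      by (subst (asm) AE_iff_null_sets[symmetric]) (use \<open>open N\<close> in auto)
    then show ?thesis by (simp add: negligible_iff_null_sets)
  qed
  ultimately have "N = {}" using open_not_negligible by blast
  then have "\<And>y. y \<in> K \<Longrightarrow> f y = 0" by (auto simp: N_def)
  then show ?thesis using continuous_constant_on_closure[OF f _ x] by blast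
qed

lemma AE_lebesgue_on_subset:
  assumes "AE x in lebesgue_on \<Omega>. P x" "K \<subseteq> \<Omega>" "K \<in> sets lebesgue" "\<Omega> \<in> sets lebesgue"
  shows "AE x in lebesgue_on K. P x"
  using assms by (auto simp: AE_restrict_space_iff elim: AE_mp)

text \<open>Near the apex the coefficient may be divided out. This gives a continuous representative of \<open>F\<close> only on a
smaller cone, where the coefficient has no zero; if \<open>F\<close> is known to have one on the whole of \<open>K\<close>, its value is
determined by the product.\<close>

lemma point_value_of_vanishing_product:
  fixes F :: "real^3 \<Rightarrow> complex^3" and q g f
  assumes th: "0 < \<theta>" "\<theta> < pi / 2" "0 < r" and K: "K = truncated_cone \<theta> r"
    and q: "continuous_on (closure K) q" "AE x in lebesgue_on K. q x = f x" "q 0 \<noteq> 0"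
    and g: "continuous_on (closure K) g" "AE x in lebesgue_on K. g x = f x *s F x" "g 0 = 0"
  shows "(\<exists>r'\<in>{0<..r}. point_value (truncated_cone \<theta> r') F 0 0) \<and> (\<forall>h. point_value K F 0 h \<longrightarrow> h = 0)"
proof
  have oK: "open K" using th K by (simp add: open_truncated_cone)
  have 0: "0 \<in> closure K" unfolding K using th by (rule zero_in_closure_truncated_cone)
  obtain \<delta> where \<delta>: "0 < \<delta>" "\<And>x. x \<in> closure K \<Longrightarrow> dist x 0 < \<delta> \<Longrightarrow> q x \<noteq> 0"
    using continuous_on_avoid[OF q(1) 0 q(3)] by (metis dist_commute)
  define r' where "r' = min r (\<delta> / 2)"
  have r': "0 < r'" "r' \<le> r" "r' < \<delta>" using th \<delta> by (auto simp: r'_def)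
  define K' where "K' = truncated_cone \<theta> r'"
  have oK': "open K'" using th by (simp add: K'_def open_truncated_cone)
  have K'K: "K' \<subseteq> K" using r' by (auto simp: K'_def K truncated_cone_def)
  then have cl: "closure K' \<subseteq> closure K" by (rule closure_mono)
  have "closure K' \<subseteq> cball 0 r'" by (rule closure_minimal) (auto simp: K'_def truncated_cone_def)
  then have q0: "q x \<noteq> 0" if "x \<in> closure K'" for x
    using \<delta>(2)[of x] that cl r' by (force simp: dist_norm)
  have "continuous_on (closure K') (\<lambda>x. inverse (q x) *s g x)"
    using q0 by (intro continuous_on_smult_vec continuous_on_inverse continuous_on_subset[OF q(1) cl] continuous_on_subset[OF g(1) cl]) auto
  moreover have "AE x in lebesgue_on K'. inverse (q x) *s g x = F x"
  proof -
    have "AE x in lebesgue_on K'. x \<in> K'" by (rule AE_I2) (simp add: space_restrict_space)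
    moreover have "AE x in lebesgue_on K'. q x = f x" "AE x in lebesgue_on K'. g x = f x *s F x"
      using q(2) g(2) K'K oK oK' by (auto intro: AE_lebesgue_on_subset[where \<Omega> = K])
    ultimately show ?thesis
    proof eventually_elim
      case (elim x)
      then have "f x \<noteq> 0" using q0[of x] closure_subset by fastforce
      then show ?case using elim by (simp add: vec_eq_iff)
    qed
  qed
  ultimately have "point_value K' F 0 0"
    unfolding point_value_def by (intro exI[of _ "\<lambda>x. inverse (q x) *s g x"]) (simp add: g(3))
  then show "\<exists>r'\<in>{0<..r}. point_value (truncated_cone \<theta> r') F 0 0"
    using r' unfolding K'_def by auto
  show "\<forall>h. point_value K F 0 h \<longrightarrow> h = 0"
  proof (intro allI impI)
    fix h assume "point_value K F 0 h"
    then obtain p where p: "continuous_on (closure K) p" "AE x in lebesgue_on K. p x = F x" "p 0 = h"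
      unfolding point_value_def by blast
    have "q 0 *s p 0 - g 0 = 0"
    proof (rule AE_zero_on_closure[OF oK _ _ 0])
      show "continuous_on (closure K) (\<lambda>x. q x *s p x - g x)"
        by (intro continuous_on_diff continuous_on_smult_vec q p g)
      show "AE x in lebesgue_on K. q x *s p x - g x = 0"
        using p(2) q(2) g(2) by eventually_elim simp
    qed
    then show "h = 0" using g(3) p(3) q(3) by (simp add: vec_eq_iff)
  qed
qed

lemma holder_on_imp_continuous_on:
  assumes "holder_on \<alpha> S g" "0 < \<alpha>" shows "continuous_on S g"
  unfolding continuous_on
proof
  fix x assume x: "x \<in> S"
  obtain C where C: "\<And>x y. x \<in> S \<Longrightarrow> y \<in> S \<Longrightarrow> norm (g x - g y) \<le> C * dist x y powr \<alpha>"
    using assms unfolding holder_on_def by auto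
  have "((\<lambda>y. dist y x powr \<alpha>) \<longlongrightarrow> 0 powr \<alpha>) (at x within S)"
    by (rule tendsto_powr') (use assms(2) in \<open>auto intro!: tendsto_eq_intros\<close>)
  then have "((\<lambda>y. C * dist y x powr \<alpha>) \<longlongrightarrow> 0) (at x within S)"
    using assms(2) by (auto intro: tendsto_mult_right_zero)
  then have "((\<lambda>y. g y - g x) \<longlongrightarrow> 0) (at x within S)"
    by (rule Lim_null_comparison[rotated]) (use C x in \<open>auto simp: eventually_at_filter\<close>)
  then show "(g \<longlongrightarrow> g x) (at x within S)" by (simp add: LIM_zero_iff)
qed


section \<open>Transmission eigenfunctions at a conical corner\<close>

theorem theorem4p1:
  fixes \<Omega> \<Gamma> :: "(real^3) set"
    and \<epsilon>\<^sub>0 \<mu>\<^sub>0 \<omega> \<theta>\<^sub>0 r\<^sub>0 \<alpha> :: real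
    and \<epsilon> \<mu> \<sigma> :: "real^3 \<Rightarrow> real"
    and \<gamma> :: "real^3 \<Rightarrow> complex"
    and Et Ht E0 H0 :: "real^3 \<Rightarrow> complex^3"
    and K :: "(real^3) set"
  assumes "lipschitz_domain \<Omega>" and "bounded \<Omega>" and "connected (- \<Omega>)"
    and "0 < \<epsilon>\<^sub>0" and "0 < \<mu>\<^sub>0" and "0 < \<omega>"
    and "\<epsilon> \<in> Linf \<Omega>" and "AE x in lebesgue_on \<Omega>. 0 < \<epsilon> x"
    and "\<mu> \<in> Linf \<Omega>" and "AE x in lebesgue_on \<Omega>. 0 < \<mu> x"
    and "\<sigma> \<in> Linf \<Omega>" and "AE x in lebesgue_on \<Omega>. 0 \<le> \<sigma> x"
    and "openin (top_of_set (frontier \<Omega>)) \<Gamma>"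
    and "transmission_eigenfunctions \<Omega> \<Gamma> \<epsilon>\<^sub>0 \<mu>\<^sub>0 \<epsilon> \<mu> \<sigma> \<omega> (Et, Ht) (E0, H0)"
    and "0 < \<theta>\<^sub>0" and "\<theta>\<^sub>0 < pi / 2" and "0 < r\<^sub>0"
    and "has_conical_corner \<Omega> \<theta>\<^sub>0 r\<^sub>0" and "0 \<in> \<Gamma>"
    and "0 < \<alpha>" and "\<alpha> < 1"
    and "K = truncated_cone \<theta>\<^sub>0 r\<^sub>0"
    and "\<gamma> = complex_permittivity \<epsilon> \<sigma> \<omega>"
    and "has_holder_rep \<alpha> K (\<lambda>x. complex_of_real (\<mu> x - \<mu>\<^sub>0) *s Ht x)"
    and "has_holder_rep \<alpha> K (\<lambda>x. (\<gamma> x - complex_of_real \<epsilon>\<^sub>0) *s Et x)"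
  shows "point_value K (\<lambda>x. complex_of_real (\<mu> x - \<mu>\<^sub>0) *s Ht x) 0 0
       \<and> point_value K (\<lambda>x. (\<gamma> x - complex_of_real \<epsilon>\<^sub>0) *s Et x) 0 0
       \<and> (\<forall>m c. point_value K \<mu> 0 m \<and> point_value K \<gamma> 0 c \<and>
            m \<noteq> \<mu>\<^sub>0 \<and> \<mu>\<^sub>0 \<noteq> 0 \<and> c \<noteq> complex_of_real \<epsilon>\<^sub>0 \<longrightarrow>
            (\<exists>r\<in>{0<..r\<^sub>0}. point_value (truncated_cone \<theta>\<^sub>0 r) Ht 0 0) \<and> (\<forall>h. point_value K Ht 0 h \<longrightarrow> h = 0) \<and>
            (\<exists>r\<in>{0<..r\<^sub>0}. point_value (truncated_cone \<theta>\<^sub>0 r) Et 0 0) \<and> (\<forall>e. point_value K Et 0 e \<longrightarrow> e = 0))"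
proof -
  note K = \<open>K = truncated_cone \<theta>\<^sub>0 r\<^sub>0\<close>
  note th = \<open>0 < \<theta>\<^sub>0\<close> \<open>\<theta>\<^sub>0 < pi / 2\<close>
  note trans = \<open>transmission_eigenfunctions \<Omega> \<Gamma> \<epsilon>\<^sub>0 \<mu>\<^sub>0 \<epsilon> \<mu> \<sigma> \<omega> (Et, Ht) (E0, H0)\<close>
  have \<Omega>: "open \<Omega>" "bounded \<Omega>"
    using \<open>lipschitz_domain \<Omega>\<close> \<open>bounded \<Omega>\<close> by (simp_all add: lipschitz_domain_def)
  have K\<Omega>: "K = \<Omega> \<inter> ball 0 r\<^sub>0"
    using \<open>has_conical_corner \<Omega> \<theta>\<^sub>0 r\<^sub>0\<close> K by (simp add: has_conical_corner_def)
  have oK: "open K" using K\<Omega> \<Omega> by (simp add: open_Int)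
  have sub: "K \<subseteq> \<Omega>" "K \<in> sets lebesgue" "\<Omega> \<in> sets lebesgue" using K\<Omega> \<Omega> oK by auto
  obtain U where U: "open U" "\<Gamma> = frontier \<Omega> \<inter> U"
    using \<open>openin (top_of_set (frontier \<Omega>)) \<Gamma>\<close> by (auto simp: openin_open)
  then obtain e where e: "0 < e" "cball 0 e \<subseteq> U"
    using \<open>0 \<in> \<Gamma>\<close> open_contains_cball by blast
  \<comment> \<open>Test fields supported in this ball see no boundary outside \<open>\<Gamma>\<close> and no part of \<open>\<Omega>\<close> outside \<open>K\<close>.\<close>
  define R where "R = min e (r\<^sub>0 / 2)"
  have R: "0 < R" "R < r\<^sub>0" using e \<open>0 < r\<^sub>0\<close> by (auto simp: R_def)
  have \<Gamma>: "cball 0 R \<subseteq> - (frontier \<Omega> - \<Gamma>)" using e U by (auto simp: R_def)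
  from \<open>has_holder_rep \<alpha> K (\<lambda>x. complex_of_real (\<mu> x - \<mu>\<^sub>0) *s Ht x)\<close>
  obtain j where j: "continuous_on (closure K) j" "AE x in lebesgue_on K. j x = complex_of_real (\<mu> x - \<mu>\<^sub>0) *s Ht x"
    using holder_on_imp_continuous_on \<open>0 < \<alpha>\<close> unfolding has_holder_rep_def by blast
  from \<open>has_holder_rep \<alpha> K (\<lambda>x. (\<gamma> x - complex_of_real \<epsilon>\<^sub>0) *s Et x)\<close>
  obtain m where m: "continuous_on (closure K) m" "AE x in lebesgue_on K. m x = (\<gamma> x - complex_of_real \<epsilon>\<^sub>0) *s Et x"
    using holder_on_imp_continuous_on \<open>0 < \<alpha>\<close> unfolding has_holder_rep_def by blast
  have Hc: "Et \<in> Hcurl \<Omega>" "Ht \<in> Hcurl \<Omega>" "E0 \<in> Hcurl \<Omega>" "H0 \<in> Hcurl \<Omega>"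
    and tr: "tangential_trace_eq_on \<Omega> \<Gamma> Et E0" "tangential_trace_eq_on \<Omega> \<Gamma> Ht H0"
    using trans by (auto simp: transmission_eigenfunctions_def maxwell_solution_def)
  have mx: "AE x in lebesgue_on K. weak_curl \<Omega> Et x - (\<i> * complex_of_real \<omega> * complex_of_real (\<mu> x)) *s Ht x = 0"
    "AE x in lebesgue_on K. weak_curl \<Omega> Ht x + (\<i> * complex_of_real \<omega> * \<gamma> x) *s Et x = 0"
    "AE x in lebesgue_on K. weak_curl \<Omega> E0 x - (\<i> * complex_of_real \<omega> * complex_of_real \<mu>\<^sub>0) *s H0 x = 0"
    "AE x in lebesgue_on K. weak_curl \<Omega> H0 x + (\<i> * complex_of_real \<omega> * complex_of_real \<epsilon>\<^sub>0) *s E0 x = 0"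
    using trans \<open>\<gamma> = complex_permittivity \<epsilon> \<sigma> \<omega>\<close>
    by (auto simp: transmission_eigenfunctions_def maxwell_solution_def intro: AE_lebesgue_on_subset[OF _ sub])
  define D where "D x = Et x - E0 x" for x
  define B where "B x = Ht x - H0 x" for x
  have L2: "D \<in> L2 K" "B \<in> L2 K"
    unfolding D_def B_def using Hc sub by (auto simp: Hcurl_def intro!: L2_diff intro: L2_subset)
  have bK: "bounded K" using K\<Omega> \<Omega> by (simp add: bounded_Int)
  have jm: "j \<in> L2 K" "m \<in> L2 K" using continuous_on_closure_L2[OF _ oK bK] j m by auto
  have meas: "(\<lambda>x. a *s F x + b *s G x) \<in> borel_measurable (lebesgue_on K)" if "F \<in> L2 K" "G \<in> L2 K" for a b F G
    using that by (intro borel_measurable_add borel_measurable_continuous_on[of "\<lambda>v. _ *s v"])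
      (auto simp: L2_def intro!: continuous_on_smult_vec continuous_intros)
  define k where "k = \<i> * complex_of_real \<omega>"
  have k: "k \<noteq> 0" using \<open>0 < \<omega>\<close> by (simp add: k_def)
  have curlD: "(\<integral>x. cdot ((k * of_real \<mu>\<^sub>0) *s B x + k *s j x) (wave R \<rho> v x) \<partial>lebesgue_on K)
        = (\<integral>x. cdot (D x) (curl (wave R \<rho> v) x) \<partial>lebesgue_on K)" for \<rho> v
    unfolding D_def
  proof (rule curl_identity_near_trace[OF \<Omega> oK K\<Omega> R \<Gamma> Hc(1,3) tr(1) _ meas[OF L2(2) jm(1)]])
    show "AE x in lebesgue_on K. weak_curl \<Omega> Et x - weak_curl \<Omega> E0 x = (k * of_real \<mu>\<^sub>0) *s B x + k *s j x"
      using mx(1,3) j(2)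
    proof eventually_elim
      case (elim x)
      then have 1: "weak_curl \<Omega> Et x = (k * of_real (\<mu> x)) *s Ht x" "weak_curl \<Omega> E0 x = (k * of_real \<mu>\<^sub>0) *s H0 x"
        by (simp_all add: k_def)
      show ?case unfolding 1 elim(3) B_def by (simp add: vec_eq_iff algebra_simps)
    qed
  qed
  have curlB: "(\<integral>x. cdot ((- k * of_real \<epsilon>\<^sub>0) *s D x + (- k) *s m x) (wave R \<rho> v x) \<partial>lebesgue_on K)
        = (\<integral>x. cdot (B x) (curl (wave R \<rho> v) x) \<partial>lebesgue_on K)" for \<rho> v
    unfolding B_def
  proof (rule curl_identity_near_trace[OF \<Omega> oK K\<Omega> R \<Gamma> Hc(2,4) tr(2) _ meas[OF L2(1) jm(2)]])
    show "AE x in lebesgue_on K. weak_curl \<Omega> Ht x - weak_curl \<Omega> H0 x = (- k * of_real \<epsilon>\<^sub>0) *s D x + (- k) *s m x"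
      using mx(2,4) m(2)
    proof eventually_elim
      case (elim x)
      then have 1: "weak_curl \<Omega> Ht x = - ((k * \<gamma> x) *s Et x)" "weak_curl \<Omega> H0 x = - ((k * of_real \<epsilon>\<^sub>0) *s E0 x)"
        by (simp_all add: k_def eq_neg_iff_add_eq_0)
      show ?case unfolding 1 elim(3) D_def by (simp add: vec_eq_iff algebra_simps)
    qed
  qed
  have j0: "j 0 = 0"
    by (rule corner_source_vanishes[OF th R K L2 j(1) m(1) k curlD curlB])
  \<comment> \<open>The same lemma with the roles of the electric and the magnetic fields exchanged.\<close>
  have m0: "m 0 = 0"
    by (rule corner_source_vanishes[OF th R K L2(2,1) m(1) j(1) _ curlB curlD]) (use k in simp)
  note quot = point_value_of_vanishing_product[OF th \<open>0 < r\<^sub>0\<close> K]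
  have "(\<exists>r\<in>{0<..r\<^sub>0}. point_value (truncated_cone \<theta>\<^sub>0 r) Ht 0 0) \<and> (\<forall>h. point_value K Ht 0 h \<longrightarrow> h = 0) \<and>
        (\<exists>r\<in>{0<..r\<^sub>0}. point_value (truncated_cone \<theta>\<^sub>0 r) Et 0 0) \<and> (\<forall>e. point_value K Et 0 e \<longrightarrow> e = 0)"
    if pv: "point_value K \<mu> 0 m'" "point_value K \<gamma> 0 c" "m' \<noteq> \<mu>\<^sub>0" "c \<noteq> complex_of_real \<epsilon>\<^sub>0" for m' c
  proof -
    obtain p where p: "continuous_on (closure K) p" "AE x in lebesgue_on K. p x = \<mu> x" "p 0 = m'"
      using pv(1) unfolding point_value_def by blast
    obtain q where q: "continuous_on (closure K) q" "AE x in lebesgue_on K. q x = \<gamma> x" "q 0 = c"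
      using pv(2) unfolding point_value_def by blast
    have "(\<exists>r\<in>{0<..r\<^sub>0}. point_value (truncated_cone \<theta>\<^sub>0 r) Ht 0 0) \<and> (\<forall>h. point_value K Ht 0 h \<longrightarrow> h = 0)"
    proof (rule quot[where q = "\<lambda>x. complex_of_real (p x - \<mu>\<^sub>0)", OF _ _ _ j j0])
      show "continuous_on (closure K) (\<lambda>x. complex_of_real (p x - \<mu>\<^sub>0))" by (intro continuous_intros p)
      show "AE x in lebesgue_on K. complex_of_real (p x - \<mu>\<^sub>0) = complex_of_real (\<mu> x - \<mu>\<^sub>0)"
        using p(2) by eventually_elim simp
    qed (use p pv in simp)
    moreover have "(\<exists>r\<in>{0<..r\<^sub>0}. point_value (truncated_cone \<theta>\<^sub>0 r) Et 0 0) \<and> (\<forall>h. point_value K Et 0 h \<longrightarrow> h = 0)"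
    proof (rule quot[where q = "\<lambda>x. q x - complex_of_real \<epsilon>\<^sub>0", OF _ _ _ m m0])
      show "continuous_on (closure K) (\<lambda>x. q x - complex_of_real \<epsilon>\<^sub>0)" by (intro continuous_intros q)
      show "AE x in lebesgue_on K. q x - complex_of_real \<epsilon>\<^sub>0 = \<gamma> x - complex_of_real \<epsilon>\<^sub>0"
        using q(2) by eventually_elim simp
    qed (use q pv in simp)
    ultimately show ?thesis by blast
  qed
  moreover have "point_value K (\<lambda>x. complex_of_real (\<mu> x - \<mu>\<^sub>0) *s Ht x) 0 0"
    unfolding point_value_def using j j0 by blast
  moreover have "point_value K (\<lambda>x. (\<gamma> x - complex_of_real \<epsilon>\<^sub>0) *s Et x) 0 0"
    unfolding point_value_def using m m0 by blast
  ultimately show ?thesis by blast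
qed

end
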